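(* Suppose Assumptions 1 and 2 (listed in the context) hold, and let $\{w^k\}_{k\ge 0}=\{(u^k,v^k,p^k)\}_{k\ge0}$ be a sequence generated by the algorithm NAPP-AL (described in the context) where at every iteration $k$ one sets $$\delta_k := \beta \left(L_G+\|q^k\|L_{\Omega}+\gamma (L^0_{\Theta})^2+\frac{14\gamma\|B\|^2(L^0_{\Theta})^2}{\lambda_{\min}(B^{\top}B)}+\frac{14(L_G+\gamma\|B\| L^0_{\Theta})^2}{\gamma\lambda_{\min}(B^{\top}B)}+1\right)^{-1}.$$ Let $\bar w$ be a cluster point of $\{w^k\}$ and let $\bar{\mathbf{W}}$ be the set of all stationary points of (P). Assume there is $\delta>0$ such that $\mathcal{L}_\gamma(w)\le\mathcal{L}_\gamma(\bar w)$ whenever $w\in\bar{\mathbf{W}}$ and $\|w-\bar w\|\le\delta$, and assume the set-valued mapping $w\mapsto\partial\mathcal{L}_{\gamma}(w)$ is metrically subregular around $(\bar w,0)$ with constants $\kappa_3>0$ and $\eta>0$, where $\eta<\delta$. Then the value proximity error bound (VP-EB) condition (defined in the context) holds at $\bar w$.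
   Context: Problem (P): minimize $F(u,v):=G(u,v)+J(u)+H(v)$ subject to $\Theta(u)+Bv=0$, $u\in\mathbf{U}$, $v\in\mathbf{R}^d$, where $\mathbf{U}\subseteq\mathbf{R}^n$ is nonempty, closed and convex, $\Theta=\Omega+\Phi:\mathbf{R}^n\to\mathbf{R}^m$ with $\Omega,\Phi$ differentiable, and $B\in\mathbf{R}^{m\times d}$. $\|\cdot\|$ is the Euclidean norm (spectral norm for matrices), $\lambda_{\min}$ the smallest eigenvalue, and ${\rm dist}(x,\mathbf{C})=\inf\{\|x-z\|:z\in \mathbf{C}\}$ ($+\infty$ if $\mathbf{C}=\emptyset$). Assumption 1. (H1) $G:\mathbf{R}^n\times\mathbf{R}^d\to\mathbf{R}$ is differentiable (possibly nonconvex) with $L_G$-Lipschitz gradient. (H2) $H:\mathbf{R}^d\to\mathbf{R}$ is differentiable (possibly nonconvex) with $L_H$-Lipschitz gradient. (H3) $J:\mathbf{R}^n\to(-\infty,+\infty]$ is proper and lower semicontinuous (possibly nonconvex); if $\mathbf{U}=\mathbf{R}^n$, ${\rm dom}(J)$ is convex; if $\mathbf{U}\neq\mathbf{R}^n$, $J$ is locally Lipschitz continuous around every point of ${\rm dom}(J)\cap\mathbf{U}$. (H4) $\|\Theta(u)-\Theta(u')\|\le L^0_\Theta\|u-u'\|$ for all $u,u'$. (H5) $\Omega=(\Omega_1,\dots,\Omega_m)^\top$ where each $\Omega_j:\mathbf{R}^n\to\mathbf{R}$ has $L_{\Omega_j}$-Lipschitz gradient; $L_\Omega:=\sum_{j=1}^m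 L_{\Omega_j}$. (H6) $B$ is a tall matrix of full column rank and ${\rm Im}(\Theta)\subseteq{\rm Im}(B)$. (H7) $F$ is bounded below and coercive over $\{(u,v)\in\mathbf{R}^n\times\mathbf{R}^d:\Theta(u)+Bv=0\}$ (coercive: $F(u,v)\to+\infty$ as $\|(u,v)\|\to\infty$ within this set). Assumption 2. (i) $K:\mathbf{R}^n\to\mathbf{R}$ is differentiable, $\beta$-strongly convex ($\beta>0$), with $L_K$-Lipschitz gradient. (ii) $\gamma>\frac{\sqrt{57}+1}{2\lambda_{\min}(B^\top B)}(L_G+L_H)$ (and $\gamma>0$). Bregman distance: $D(u,u')=K(u)-K(u')-\langle\nabla K(u'),u-u'\rangle$. Algorithm NAPP-AL. Fix $\sigma\in(0,1)$ and start from $u^0\in\mathbf{R}^n,v^0\in\mathbf{R}^d,p^0\in\mathbf{R}^m$. For $k=0,1,2,\dots$: set $q^k=p^k+\gamma(\Theta(u^k)+Bv^k)$, take $\delta_k>0$ and $\epsilon^k$ with $\sigma\delta_k\le\epsilon^k\le\delta_k$, and let $$u^{k+1}\in\arg\min_{u\in\mathbf{U}}\ \langle\nabla_uG(u^k,v^k),u\rangle+J(u)+\langle q^k,\nabla\Omega(u^k)u+\Phi(u)\rangle+\tfrac1{\epsilon^k}D(u,u^k),$$ $$v^{k+1}=\arg\min_{v\in\mathbf{R}^d}\ \langle\nabla_vG(u^k,v^k)+\nabla H(v^k),v\rangle+\langle q^k,Bv\rangle+\tfrac\gamma2\|B(v-v^k)\|^2,$$ $$p^{k+1}=p^k+\gamma(\Theta(u^{k+1})+Bv^{k+1}).$$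 The $u$-subproblem is assumed to be solved to global optimality (a global minimizer is assumed to exist). Write $w^k=(u^k,v^k,p^k)$. Augmented Lagrangian: for $w=(u,v,p)$, $\mathcal{L}_\gamma(w)=F(u,v)+\langle p,\Theta(u)+Bv\rangle+\frac\gamma2\|\Theta(u)+Bv\|^2$. For $w\in\mathbf{U}\times\mathbf{R}^d\times\mathbf{R}^m$, $\partial\mathcal{L}_\gamma(w)$ denotes the product of the three sets $\nabla_uG(u,v)+\partial J(u)+\mathcal{N}_{\mathbf{U}}(u)+(\nabla\Theta(u))^\top[p+\gamma(\Theta(u)+Bv)]$, $\{\nabla_vG(u,v)+\nabla H(v)+B^\top[p+\gamma(\Theta(u)+Bv)]\}$, $\{\Theta(u)+Bv\}$, where $\partial J$ is the limiting (Mordukhovich) subdifferential and $\mathcal{N}_{\mathbf{U}}(u)=\{\xi:\langle\xi,\zeta-u\rangle\le0\ \forall\zeta\in\mathbf{U}\}$; for $u\notin\mathbf{U}$ it is empty. A stationary point of (P) is a $w\in\mathbf{U}\times\mathbf{R}^d\times\mathbf{R}^m$ with $0\in\partial\mathcal{L}_\gamma(w)$; $\bar{\mathbf{W}}=(\partial\mathcal{L}_\gamma)^{-1}(0)$ is the set of these. $\Lambda^*:=\mathcal{L}_\gamma(\bar w)$, which under Assumptions 1 and 2 and the choice of $\delta_k$ made in the claim is the common value of $\mathcal{L}_\gamma$ at all cluster points of $\{w^k\}$ and equals $\lim_k\mathcal{L}_\gamma(w^k)$; all cluster points are stationary points of (P). $\mathbb{B}(\bar w;\eta)$ is the open ball of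 radius $\eta$ centered at $\bar w$. A set-valued mapping $\mathcal{H}$ is metrically subregular around $(\bar w,0)$ with constants $\kappa_3>0,\eta>0$ if ${\rm dist}(w,\mathcal{H}^{-1}(0))\le\kappa_3\,{\rm dist}(0,\mathcal{H}(w))$ for all $w\in\mathbb{B}(\bar w;\eta)$. VP-EB condition at $\bar w$ for the sequence $\{w^k\}$: there exist $\kappa_1>0,\eta>0,\nu>0$ (this $\eta$ need not be the same as the radius $\eta$ appearing in the metric subregularity hypothesis) such that $\mathcal{L}_\gamma(w^{k+1})-\Lambda^*\le\kappa_1\|w^k-w^{k+1}\|^2$ for every $k$ with $w^{k+1}\in\mathbb{B}(\bar w;\eta)$ and $\mathcal{L}_\gamma(w^{k+1})<\Lambda^*+\nu$. *)

theory Defs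
  imports "HOL-Analysis.Analysis"
begin

section \<open>Smooth functions\<close>

definition grad :: "('a::real_inner \<Rightarrow> real) \<Rightarrow> 'a \<Rightarrow> 'a" where
  "grad f x = (THE D. GDERIV f x :> D)"

definition lipschitz_gradient :: "real \<Rightarrow> ('a::real_inner \<Rightarrow> real) \<Rightarrow> bool" where
  "lipschitz_gradient L f \<longleftrightarrow> f differentiable_on UNIV \<and> L-lipschitz_on UNIV (grad f)"

definition grad1 :: "('a::real_inner \<times> 'b::real_inner \<Rightarrow> real) \<Rightarrow> 'a \<Rightarrow> 'b \<Rightarrow> 'a" where
  "grad1 G u v = grad (\<lambda>x. G (x, v)) u"

definition grad2 :: "('a::real_inner \<times> 'b::real_inner \<Rightarrow> real) \<Rightarrow> 'a \<Rightarrow> 'b \<Rightarrow> 'b" where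
  "grad2 G u v = grad (\<lambda>y. G (u, y)) v"

definition strongly_convex :: "real \<Rightarrow> ('a::real_inner \<Rightarrow> real) \<Rightarrow> bool" where
  "strongly_convex \<beta> K \<longleftrightarrow>
    (\<forall>x y. \<forall>t\<in>{0..1}. K (t *\<^sub>R x + (1 - t) *\<^sub>R y)
        \<le> t * K x + (1 - t) * K y - \<beta> / 2 * t * (1 - t) * (norm (x - y))\<^sup>2)"

definition bregman :: "('a::real_inner \<Rightarrow> real) \<Rightarrow> 'a \<Rightarrow> 'a \<Rightarrow> real" where
  "bregman K u u' = K u - K u' - grad K u' \<bullet> (u - u')"

section \<open>Matrices\<close>

definition lambda_min :: "real^'n^'n \<Rightarrow> real" where
  "lambda_min A = Min {l. \<exists>x. x \<noteq> 0 \<and> A *v x = l *\<^sub>R x}"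

text \<open>The operator norm induced by the Euclidean norms; \<open>norm B\<close> would be the Frobenius norm.\<close>

definition spectral_norm :: "real^'n^'m \<Rightarrow> real" where
  "spectral_norm B = onorm (\<lambda>x. B *v x)"

section \<open>Extended-real-valued functions and variational analysis\<close>

definition edom :: "('a \<Rightarrow> ereal) \<Rightarrow> 'a set" where
  "edom f = {x. f x < \<infinity>}"

definition proper :: "('a \<Rightarrow> ereal) \<Rightarrow> bool" where
  "proper f \<longleftrightarrow> (\<forall>x. f x \<noteq> -\<infinity>) \<and> edom f \<noteq> {}"

definition lsc :: "('a::topological_space \<Rightarrow> ereal) \<Rightarrow> bool" where
  "lsc f \<longleftrightarrow> (\<forall>x. f x \<le> Liminf (at x) f)"

text \<open>Local Lipschitz continuity around a point entails finiteness on a full neighbourhood.\<close>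

definition lipschitz_around :: "('a::metric_space \<Rightarrow> ereal) \<Rightarrow> 'a \<Rightarrow> bool" where
  "lipschitz_around f x \<longleftrightarrow>
    (\<exists>e>0. \<exists>L. (\<forall>y\<in>ball x e. \<bar>f y\<bar> \<noteq> \<infinity>) \<and>
               L-lipschitz_on (ball x e) (\<lambda>y. real_of_ereal (f y)))"

text \<open>The regular (Frechet) subdifferential, and the limiting (Mordukhovich) one as the outer limit
  of regular subgradients along \<open>f\<close>-attentive convergence.  Both are empty where \<open>f\<close> is not finite.\<close>

definition regular_subdiff :: "('a::real_inner \<Rightarrow> ereal) \<Rightarrow> 'a \<Rightarrow> 'a set" where
  "regular_subdiff f x = {\<xi>. \<bar>f x\<bar> \<noteq> \<infinity> \<and>
     0 \<le> Liminf (at x) (\<lambda>y. (f y - f x - ereal (\<xi> \<bullet> (y - x))) / ereal (norm (y - x)))}"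

definition limiting_subdiff :: "('a::real_inner \<Rightarrow> ereal) \<Rightarrow> 'a \<Rightarrow> 'a set" where
  "limiting_subdiff f x = {\<xi>. \<bar>f x\<bar> \<noteq> \<infinity> \<and>
     (\<exists>X \<Xi>. X \<longlonglongrightarrow> x \<and> (\<lambda>i. f (X i)) \<longlonglongrightarrow> f x \<and>
            (\<forall>i. \<Xi> i \<in> regular_subdiff f (X i)) \<and> \<Xi> \<longlonglongrightarrow> \<xi>)}"

definition normal_cone :: "'a::real_inner set \<Rightarrow> 'a \<Rightarrow> 'a set" where
  "normal_cone U u = {\<xi>. \<forall>\<zeta>\<in>U. \<xi> \<bullet> (\<zeta> - u) \<le> 0}"

text \<open>Unlike \<^const>\<open>infdist\<close>, the distance to the empty set is \<open>\<infinity>\<close>.\<close>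

definition edist_set :: "'a::metric_space \<Rightarrow> 'a set \<Rightarrow> ereal" where
  "edist_set x C = (INF z\<in>C. ereal (dist x z))"

definition metrically_subregular ::
  "('a::metric_space \<Rightarrow> 'b::{metric_space,zero} set) \<Rightarrow> 'a \<Rightarrow> real \<Rightarrow> real \<Rightarrow> bool" where
  "metrically_subregular \<H> wbar \<kappa> \<eta> \<longleftrightarrow>
    (\<forall>w\<in>ball wbar \<eta>. edist_set w {x. 0 \<in> \<H> x} \<le> ereal \<kappa> * edist_set 0 (\<H> w))"

definition cluster_point :: "(nat \<Rightarrow> 'a::topological_space) \<Rightarrow> 'a \<Rightarrow> bool" where
  "cluster_point w wbar \<longleftrightarrow> (\<exists>r. strict_mono r \<and> (w \<circ> r) \<longlonglongrightarrow> wbar)"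

section \<open>The problem, its augmented Lagrangian and the algorithm\<close>

definition objective ::
  "((real^'n) \<times> (real^'d) \<Rightarrow> real) \<Rightarrow> (real^'n \<Rightarrow> ereal) \<Rightarrow> (real^'d \<Rightarrow> real)
    \<Rightarrow> (real^'n) \<times> (real^'d) \<Rightarrow> ereal" where
  "objective G J H = (\<lambda>(u, v). ereal (G (u, v)) + J u + ereal (H v))"

definition feasible ::
  "(real^'n \<Rightarrow> real^'m) \<Rightarrow> real^'d^'m \<Rightarrow> ((real^'n) \<times> (real^'d)) set" where
  "feasible \<Theta> B = {(u, v). \<Theta> u + B *v v = 0}"

definition aug_lagrangian ::
  "((real^'n) \<times> (real^'d) \<Rightarrow> real) \<Rightarrow> (real^'n \<Rightarrow> ereal) \<Rightarrow> (real^'d \<Rightarrow> real)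
    \<Rightarrow> (real^'n \<Rightarrow> real^'m) \<Rightarrow> real^'d^'m \<Rightarrow> real
    \<Rightarrow> (real^'n) \<times> (real^'d) \<times> (real^'m) \<Rightarrow> ereal" where
  "aug_lagrangian G J H \<Theta> B \<gamma> = (\<lambda>(u, v, p).
     objective G J H (u, v)
     + ereal (p \<bullet> (\<Theta> u + B *v v) + \<gamma> / 2 * (norm (\<Theta> u + B *v v))\<^sup>2))"

definition aug_lagrangian_subdiff ::
  "(real^'n) set \<Rightarrow> ((real^'n) \<times> (real^'d) \<Rightarrow> real) \<Rightarrow> (real^'n \<Rightarrow> ereal) \<Rightarrow> (real^'d \<Rightarrow> real)
    \<Rightarrow> (real^'n \<Rightarrow> real^'m) \<Rightarrow> real^'d^'m \<Rightarrow> real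
    \<Rightarrow> (real^'n) \<times> (real^'d) \<times> (real^'m) \<Rightarrow> ((real^'n) \<times> (real^'d) \<times> (real^'m)) set" where
  "aug_lagrangian_subdiff U G J H \<Theta> B \<gamma> = (\<lambda>(u, v, p).
     if u \<in> U then
       {grad1 G u v + \<xi> + \<zeta>
          + transpose (jacobian \<Theta> (at u)) *v (p + \<gamma> *\<^sub>R (\<Theta> u + B *v v))
        | \<xi> \<zeta>. \<xi> \<in> limiting_subdiff J u \<and> \<zeta> \<in> normal_cone U u}
       \<times> {grad2 G u v + grad H v + transpose B *v (p + \<gamma> *\<^sub>R (\<Theta> u + B *v v))}
       \<times> {\<Theta> u + B *v v}
     else {})"

definition stationary_points ::
  "(real^'n) set \<Rightarrow> ((real^'n) \<times> (real^'d) \<Rightarrow> real) \<Rightarrow> (real^'n \<Rightarrow> ereal) \<Rightarrow> (real^'d \<Rightarrow> real)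
    \<Rightarrow> (real^'n \<Rightarrow> real^'m) \<Rightarrow> real^'d^'m \<Rightarrow> real
    \<Rightarrow> ((real^'n) \<times> (real^'d) \<times> (real^'m)) set" where
  "stationary_points U G J H \<Theta> B \<gamma> = {w. 0 \<in> aug_lagrangian_subdiff U G J H \<Theta> B \<gamma> w}"

definition multiplier_estimate ::
  "(real^'n \<Rightarrow> real^'m) \<Rightarrow> real^'d^'m \<Rightarrow> real \<Rightarrow> real^'n \<Rightarrow> real^'d \<Rightarrow> real^'m \<Rightarrow> real^'m" where
  "multiplier_estimate \<Theta> B \<gamma> u v p = p + \<gamma> *\<^sub>R (\<Theta> u + B *v v)"

text \<open>The initial point \<open>(u 0, v 0, p 0)\<close> is arbitrary; in particular \<open>u 0\<close> need not lie in \<open>U\<close>.\<close>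

definition napp_al ::
  "(real^'n) set \<Rightarrow> ((real^'n) \<times> (real^'d) \<Rightarrow> real) \<Rightarrow> (real^'n \<Rightarrow> ereal) \<Rightarrow> (real^'d \<Rightarrow> real)
    \<Rightarrow> (real^'n \<Rightarrow> real^'m) \<Rightarrow> (real^'n \<Rightarrow> real^'m) \<Rightarrow> real^'d^'m \<Rightarrow> (real^'n \<Rightarrow> real) \<Rightarrow> real \<Rightarrow> real
    \<Rightarrow> (nat \<Rightarrow> real) \<Rightarrow> (nat \<Rightarrow> real)
    \<Rightarrow> (nat \<Rightarrow> real^'n) \<Rightarrow> (nat \<Rightarrow> real^'d) \<Rightarrow> (nat \<Rightarrow> real^'m) \<Rightarrow> bool" where
  "napp_al U G J H \<Omega> \<Phi> B K \<gamma> \<sigma> \<delta> \<epsilon> u v p \<longleftrightarrow>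
    (\<forall>k. let \<Theta> = (\<lambda>x. \<Omega> x + \<Phi> x);
             q = multiplier_estimate \<Theta> B \<gamma> (u k) (v k) (p k)
      in \<delta> k > 0 \<and> \<sigma> * \<delta> k \<le> \<epsilon> k \<and> \<epsilon> k \<le> \<delta> k \<and>
         is_arg_min
           (\<lambda>x. ereal (grad1 G (u k) (v k) \<bullet> x) + J x
                + ereal (q \<bullet> (jacobian \<Omega> (at (u k)) *v x + \<Phi> x)
                         + 1 / \<epsilon> k * bregman K x (u k)))
           (\<lambda>x. x \<in> U) (u (Suc k)) \<and>
         is_arg_min
           (\<lambda>y. (grad2 G (u k) (v k) + grad H (v k)) \<bullet> y + q \<bullet> (B *v y)
                + \<gamma> / 2 * (norm (B *v (y - v k)))\<^sup>2)
           (\<lambda>y. True) (v (Suc k)) \<and>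
         p (Suc k) = p k + \<gamma> *\<^sub>R (\<Theta> (u (Suc k)) + B *v v (Suc k)))"

definition vp_eb ::
  "('a::real_normed_vector \<Rightarrow> ereal) \<Rightarrow> (nat \<Rightarrow> 'a) \<Rightarrow> 'a \<Rightarrow> bool" where
  "vp_eb L w wbar \<longleftrightarrow>
    (\<exists>\<kappa>>0. \<exists>\<eta>>0. \<exists>\<nu>>0. \<forall>k.
       w (Suc k) \<in> ball wbar \<eta> \<and> L (w (Suc k)) < L wbar + ereal \<nu> \<longrightarrow>
       L (w (Suc k)) - L wbar \<le> ereal (\<kappa> * (norm (w k - w (Suc k)))\<^sup>2))"

end

theory Submission
  imports Defs
begin

text \<open>Let \<open>d\<close> be the length of the step ending in \<open>w (Suc k)\<close>. If \<open>d\<close> is not small, the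
  bound follows from \<open>L (w (Suc k)) < L wbar + \<nu>\<close> alone. If \<open>d\<close> is small, \<open>w k\<close> is close to \<open>wbar\<close>
  too, so \<open>q k\<close> and hence \<open>1 / \<epsilon> k\<close> are bounded, and the optimality conditions of the two
  subproblems yield a subgradient of \<open>L\<close> at \<open>w (Suc k)\<close> of norm \<open>O(d)\<close>. Metric subregularity
  turns it into a stationary point \<open>z\<close> at distance \<open>O(d)\<close>, with \<open>L z \<le> L wbar\<close>. Comparing
  \<open>u (Suc k)\<close> with the first component of \<open>z\<close> in the \<open>u\<close>-subproblem, which is solved
  globally, gives \<open>L (w (Suc k)) - L z = O(d\<^sup>2)\<close>.\<close>

section \<open>Gradients and Jacobians\<close>

text \<open>Two obstacles shape the proof. Global optimality in the \<open>u\<close>-subproblem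
  concerns \<open>J\<close> plus the indicator of \<open>U\<close>, whereas
  \<open>aug_lagrangian_subdiff\<close> asks for a limiting subgradient of \<open>J\<close> and a
  normal vector to \<open>U\<close> separately. For nonconvex \<open>J\<close> this splitting is a
  sum rule, proved here by a penalty argument. Moreover, a small subgradient of a nonconvex function
  does not control differences of its values. Minimality in the \<open>u\<close>-subproblem is
  therefore used twice: once for its first-order condition, which leads to the stationary point, and
  once as an inequality between values with that point as competitor. The second use gives an error
  of second order because all gradients of the algorithm are taken at the same old iterate, and
  because the competitor is exactly feasible while the new iterate is feasible up to
  \<open>O(d)\<close>.\<close>

lemma has_derivative_grad:
  fixes f :: "'a::euclidean_space \<Rightarrow> real"
  assumes "f differentiable (at x)"
  shows "(f has_derivative (\<lambda>h. grad f x \<bullet> h)) (at x)"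
proof -
  obtain F where F: "(f has_derivative F) (at x)"
    using assms unfolding differentiable_def by blast
  \<comment> \<open>The Riesz vector of \<open>F\<close> in the standard basis is the witness for
    the \<open>THE\<close> in \<open>grad\<close>.\<close>
  have "F h = h \<bullet> (\<Sum>b\<in>Basis. F b *\<^sub>R b)" for h
    by (rule trans[OF Linear_Algebra.linear_componentwise[OF has_derivative_linear[OF F], of h 1, simplified]])
      (simp add: inner_sum_right mult.commute)
  then have "F = (\<lambda>h. h \<bullet> (\<Sum>b\<in>Basis. F b *\<^sub>R b))" ..
  with F have G: "GDERIV f x :> (\<Sum>b\<in>Basis. F b *\<^sub>R b)"
    unfolding gderiv_def by (simp only: inner_commute)
  have "GDERIV f x :> grad f x"
    unfolding grad_def
  proof (rule theI[of "\<lambda>D. GDERIV f x :> D", OF G])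
    fix D assume D: "GDERIV f x :> D"
    have "(\<lambda>h. h \<bullet> D) = (\<lambda>h. h \<bullet> (\<Sum>b\<in>Basis. F b *\<^sub>R b))"
      by (rule has_derivative_unique[OF D[unfolded gderiv_def] G[unfolded gderiv_def]])
    then show "D = (\<Sum>b\<in>Basis. F b *\<^sub>R b)"
      by (simp only: fun_eq_iff vector_eq_ldot)
  qed
  then show ?thesis unfolding gderiv_def by (simp add: inner_commute)
qed

lemma grad_eqI:
  fixes f :: "'a::euclidean_space \<Rightarrow> real"
  assumes "(f has_derivative (\<lambda>h. D \<bullet> h)) (at x)"
  shows "grad f x = D"
proof -
  have "f differentiable (at x)" using assms unfolding differentiable_def by blast
  from has_derivative_unique[OF has_derivative_grad[OF this] assms] show ?thesis
    by (simp only: fun_eq_iff vector_eq_rdot)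
qed

lemma grad_partials:
  fixes G :: "'a::euclidean_space \<times> 'b::euclidean_space \<Rightarrow> real"
  assumes "G differentiable (at (u, v))"
  shows "grad G (u, v) = (grad1 G u v, grad2 G u v)"
proof -
  note D = has_derivative_grad[OF assms]
  have "((\<lambda>x. G (x, v)) has_derivative (\<lambda>h. grad G (u, v) \<bullet> (h, 0))) (at u)"
    by (rule has_derivative_compose[where f = "\<lambda>x. (x, v)", OF _ D]) (auto intro!: derivative_eq_intros)
  moreover have "((\<lambda>y. G (u, y)) has_derivative (\<lambda>h. grad G (u, v) \<bullet> (0, h))) (at v)"
    by (rule has_derivative_compose[where f = "\<lambda>y. (u, y)", OF _ D]) (auto intro!: derivative_eq_intros)
  ultimately have "grad1 G u v = fst (grad G (u, v))" "grad2 G u v = snd (grad G (u, v))"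
    unfolding grad1_def grad2_def by (auto intro!: grad_eqI simp: inner_prod_def)
  then show ?thesis by simp
qed

lemma lipschitz_gradient_derivative:
  fixes f :: "'a::euclidean_space \<Rightarrow> real"
  assumes "lipschitz_gradient L f"
  shows "(f has_derivative (\<lambda>h. grad f x \<bullet> h)) (at x)"
  using assms unfolding lipschitz_gradient_def differentiable_on_def
  by (auto intro: has_derivative_grad)

lemma lipschitz_gradient_nonneg: "lipschitz_gradient L f \<Longrightarrow> 0 \<le> L"
  unfolding lipschitz_gradient_def by (auto dest: lipschitz_on_nonneg)

lemma lipschitz_gradient_norm_diff:
  "lipschitz_gradient L f \<Longrightarrow> norm (grad f x - grad f y) \<le> L * norm (x - y)"
  unfolding lipschitz_gradient_def by (auto dest!: lipschitz_onD[of _ _ _ x y] simp: dist_norm)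

text \<open>The mean value theorem is applied to the remainder along the segment. It gives
  \<open>L\<close> where integration would give \<open>L / 2\<close>; only the final constant is
  affected.\<close>

lemma lipschitz_gradient_taylor:
  fixes f :: "'a::euclidean_space \<Rightarrow> real"
  assumes L: "lipschitz_gradient L f"
  shows "\<bar>f y - f x - grad f x \<bullet> (y - x)\<bar> \<le> L * (norm (y - x))\<^sup>2"
proof -
  have "((\<lambda>t. f (x + t *\<^sub>R (y - x)) - grad f x \<bullet> (t *\<^sub>R (y - x))) has_derivative
       (\<lambda>h. (grad f (x + t *\<^sub>R (y - x)) - grad f x) \<bullet> (h *\<^sub>R (y - x)))) (at t)" for t
    by (rule derivative_eq_intros has_derivative_compose[OF _ lipschitz_gradient_derivative[OF L]] refl | simp add: inner_diff_left right_diff_distrib)+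
  then have "\<exists>t::real. 0 < t \<and> t < 1 \<and>
      (f (x + 1 *\<^sub>R (y - x)) - grad f x \<bullet> (1 *\<^sub>R (y - x))) -
      (f (x + 0 *\<^sub>R (y - x)) - grad f x \<bullet> (0 *\<^sub>R (y - x)))
       = (grad f (x + t *\<^sub>R (y - x)) - grad f x) \<bullet> ((1 - 0) *\<^sub>R (y - x))"
    by (intro mvt_simple[of 0 1, simplified Bex_def greaterThanLessThan_iff, simplified]) (auto intro: has_derivative_at_withinI)
  then obtain t :: real where t: "0 < t" "t < 1"
    and e: "f y - f x - grad f x \<bullet> (y - x) = (grad f (x + t *\<^sub>R (y - x)) - grad f x) \<bullet> (y - x)"
    by (auto simp: algebra_simps)
  have "\<bar>(grad f (x + t *\<^sub>R (y - x)) - grad f x) \<bullet> (y - x)\<bar>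
      \<le> (L * norm (t *\<^sub>R (y - x))) * norm (y - x)"
    using lipschitz_gradient_norm_diff[OF L, of "x + t *\<^sub>R (y - x)" x]
    by (intro order.trans[OF Cauchy_Schwarz_ineq2] mult_right_mono) auto
  also have "\<dots> \<le> (L * (1 * norm (y - x))) * norm (y - x)"
    using t lipschitz_gradient_nonneg[OF L]
    by (intro mult_right_mono mult_left_mono) (auto simp: mult_left_le_one_le)
  finally show ?thesis using e by (simp add: power2_eq_square)
qed

text \<open>Pairing \<open>transpose A *v y\<close> with itself moves one factor back through
  \<open>A\<close>, and one norm cancels. Bounds for Jacobians thus pass to their transposes, which
  act on multipliers.\<close>

lemma norm_transpose_mult_le:
  fixes A :: "real^'n^'m"
  assumes "\<And>x. norm (A *v x) \<le> c * norm x" and "0 \<le> c"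
  shows "norm (transpose A *v y) \<le> c * norm y"
proof (cases "transpose A *v y = 0")
  case False
  have "(norm (transpose A *v y))\<^sup>2 = (A *v (transpose A *v y)) \<bullet> y"
    by (simp add: power2_norm_eq_inner dot_lmul_matrix[symmetric] transpose_matrix_vector inner_commute)
  also have "\<dots> \<le> (c * norm (transpose A *v y)) * norm y"
    by (intro order.trans[OF norm_cauchy_schwarz] mult_right_mono assms) auto
  finally show ?thesis using False by (simp add: power2_eq_square algebra_simps)
qed (use assms in auto)

lemma jacobian_mult_component:
  fixes f :: "real^'n \<Rightarrow> real^'m"
  assumes "f differentiable (at x)"
  shows "(jacobian f (at x) *v h) $ j = grad (\<lambda>x. f x $ j) x \<bullet> h"
proof -
  have "(f has_derivative (*v) (jacobian f (at x))) (at x)"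
    using assms by (simp add: jacobian_works)
  then have "((\<lambda>x. f x $ j) has_derivative (\<lambda>h. (jacobian f (at x) *v h) $ j)) (at x)"
    by (rule bounded_linear.has_derivative[OF bounded_linear_vec_nth])
  then show ?thesis
    using has_derivative_unique[OF _ has_derivative_grad, of "\<lambda>x. f x $ j"]
    by (metis differentiable_def)
qed

text \<open>The difference quotient along \<open>h\<close> is bounded by \<open>L * norm h\<close>,
  and this survives the limit as \<open>t\<close> tends to 0.\<close>

lemma norm_jacobian_mult_le:
  fixes f :: "real^'n \<Rightarrow> real^'m"
  assumes "f differentiable (at x)" and L: "\<And>y. norm (f y - f x) \<le> L * norm (y - x)"
  shows "norm (jacobian f (at x) *v h) \<le> L * norm h"
proof -
  have D: "(f has_derivative (*v) (jacobian f (at x))) (at x)"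
    using assms by (simp add: jacobian_works)
  have "((\<lambda>t. f (x + t *\<^sub>R h)) has_derivative (\<lambda>t. jacobian f (at x) *v (t *\<^sub>R h))) (at 0)"
    by (rule has_derivative_compose[where f = "\<lambda>t. x + t *\<^sub>R h"])
      (use D in \<open>auto intro!: derivative_eq_intros\<close>)
  then have "((\<lambda>t. norm (f (x + t *\<^sub>R h) - f x - t *\<^sub>R (jacobian f (at x) *v h)) / \<bar>t\<bar>) \<longlongrightarrow> 0) (at 0)"
    by (simp add: has_derivative_at matrix_vector_mult_scaleR)
  then have "((\<lambda>t. L * norm h + norm (f (x + t *\<^sub>R h) - f x - t *\<^sub>R (jacobian f (at x) *v h)) / \<bar>t\<bar>)
      \<longlongrightarrow> L * norm h + 0) (at 0)"
    by (intro tendsto_intros)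
  moreover have "\<forall>\<^sub>F t in at 0. norm (jacobian f (at x) *v h)
      \<le> L * norm h + norm (f (x + t *\<^sub>R h) - f x - t *\<^sub>R (jacobian f (at x) *v h)) / \<bar>t\<bar>"
    unfolding eventually_at_filter
  proof (intro always_eventually allI impI)
    fix t :: real assume t: "t \<noteq> 0"
    have "\<bar>t\<bar> * norm (jacobian f (at x) *v h) \<le> norm (f (x + t *\<^sub>R h) - f x)
        + norm (f (x + t *\<^sub>R h) - f x - t *\<^sub>R (jacobian f (at x) *v h))"
      using norm_triangle_ineq4[of "f (x + t *\<^sub>R h) - f x"
          "f (x + t *\<^sub>R h) - f x - t *\<^sub>R (jacobian f (at x) *v h)"] by simp
    also have "norm (f (x + t *\<^sub>R h) - f x) \<le> L * (\<bar>t\<bar> * norm h)"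
      using L[of "x + t *\<^sub>R h"] by simp
    finally show "norm (jacobian f (at x) *v h) \<le> L * norm h
        + norm (f (x + t *\<^sub>R h) - f x - t *\<^sub>R (jacobian f (at x) *v h)) / \<bar>t\<bar>"
      using t by (simp add: field_simps)
  qed
  ultimately show ?thesis
    using tendsto_lowerbound[of _ "L * norm h + 0" "at (0::real)" "norm (jacobian f (at x) *v h)"]
    by (simp add: trivial_limit_at)
qed

section \<open>A sum rule for limiting subgradients and normal cones\<close>

text \<open>Clearing the denominator shows that the lower limit is at least \<open>- e\<close> for
  every positive \<open>e\<close>. Later uses then need no division in \<open>ereal\<close>.\<close>

lemma regular_subdiffI:
  fixes f :: "'a::real_inner \<Rightarrow> ereal"
  assumes fin: "\<bar>f x\<bar> \<noteq> \<infinity>"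
    and le: "\<And>e::real. e > 0 \<Longrightarrow> \<forall>\<^sub>F y in at x. f x + ereal (\<xi> \<bullet> (y - x) - e * norm (y - x)) \<le> f y"
  shows "\<xi> \<in> regular_subdiff f x"
proof -
  let ?Q = "\<lambda>y. (f y - f x - ereal (\<xi> \<bullet> (y - x))) / ereal (norm (y - x))"
  obtain r where r: "f x = ereal r" using fin by auto
  have "0 \<le> Liminf (at x) ?Q"
  proof (rule ereal_le_epsilon2)
    fix e :: real assume e: "0 < e"
    have "\<forall>\<^sub>F y in at x. ereal (- e) \<le> ?Q y"
      using le[OF e] eventually_neq_at_within[of x x UNIV]
    proof eventually_elim
      case (elim y)
      then have n: "norm (y - x) > 0" by simp
      show ?case
        using elim n r by (cases "f y") (auto simp: field_simps)
    qed
    then have "ereal (- e) \<le> Liminf (at x) ?Q"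
      by (rule Liminf_bounded)
    then show "0 \<le> Liminf (at x) ?Q + ereal e"
      by (cases "Liminf (at x) ?Q") auto
  qed
  then show ?thesis using fin unfolding regular_subdiff_def by blast
qed

lemma limiting_subdiffI:
  assumes "\<bar>f x\<bar> \<noteq> \<infinity>" "X \<longlonglongrightarrow> x" "(\<lambda>i. f (X i)) \<longlonglongrightarrow> f x"
    and "\<And>i. N i \<in> regular_subdiff f (X i)" "N \<longlonglongrightarrow> \<xi>"
  shows "\<xi> \<in> limiting_subdiff f x"
  unfolding limiting_subdiff_def mem_Collect_eq using assms by blast

lemma regular_subdiff_subset_limiting: "regular_subdiff f x \<subseteq> limiting_subdiff f x"
proof
  fix \<xi> assume \<xi>: "\<xi> \<in> regular_subdiff f x"
  then show "\<xi> \<in> limiting_subdiff f x"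
    by (intro limiting_subdiffI[where X = "\<lambda>_. x" and N = "\<lambda>_. \<xi>"])
      (auto simp: regular_subdiff_def)
qed

lemma power2_norm_diff:
  fixes a b :: "'a::real_inner"
  shows "(norm (a - b))\<^sup>2 = (norm a)\<^sup>2 - 2 * (a \<bullet> b) + (norm b)\<^sup>2"
  by (simp add: power2_norm_eq_inner inner_diff_left inner_diff_right inner_commute)

text \<open>Decoupling by the penalty \<open>i/2 * (norm (y - z))\<^sup>2\<close>: the function \<open>j\<close> is
  minimised in \<open>y\<close> and the constraint \<open>z \<in> U\<close> carries the slack \<open>2 * e * norm (z - x)\<close>,
  so that optimality in \<open>y\<close> produces an exact regular subgradient.\<close>

lemma fuzzy_sum_rule:
  fixes J :: "'a::euclidean_space \<Rightarrow> ereal"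
  assumes U: "closed U" "convex U" "x \<in> U"
    and fin: "\<And>y. y \<in> ball x e0 \<Longrightarrow> \<bar>J y\<bar> \<noteq> \<infinity>" and "e0 > 0"
    and lip: "L-lipschitz_on (ball x e0) (\<lambda>y. real_of_ereal (J y))"
    and sub: "\<And>e::real. e > 0 \<Longrightarrow> \<exists>r>0. \<forall>y\<in>U. norm (y - x) \<le> r \<longrightarrow>
                J x + ereal (\<xi> \<bullet> (y - x) - e * norm (y - x)) \<le> J y"
    and e: "e > 0"
  shows "\<exists>y z \<eta>. norm (y - x) < e \<and> y \<in> ball x e0 \<and> norm (z - x) < e \<and> \<eta> \<in> regular_subdiff J y \<and>
           norm \<eta> \<le> 3 * norm \<xi> + 2 * L \<and>
           (\<forall>z'\<in>U. (\<xi> - \<eta>) \<bullet> (z' - z) \<le> 2 * e * norm (z' - z))"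
proof -
  define j where "j y = real_of_ereal (J y)" for y
  have Jj: "J y = ereal (j y)" if "y \<in> ball x e0" for y
    using fin[OF that] unfolding j_def by (simp add: ereal_real')
  obtain r0 where r0: "r0 > 0" "\<And>y. y \<in> U \<Longrightarrow> norm (y - x) \<le> r0 \<Longrightarrow>
      J x + ereal (\<xi> \<bullet> (y - x) - e * norm (y - x)) \<le> J y"
    using sub[OF e] by blast
  define r where "r = min (min (e0 / 2) e) r0"
  have r: "r > 0" "r < e0" "r \<le> e" "r \<le> r0" using r0 e \<open>e0 > 0\<close> unfolding r_def by auto
  have inb: "y \<in> ball x e0" if "norm (y - x) \<le> r" for y
    using that r by (simp add: dist_norm norm_minus_commute)
  have L0: "0 \<le> L" using lip by (rule lipschitz_on_nonneg)
  have jL: "\<bar>j a - j b\<bar> \<le> L * norm (a - b)" if "norm (a - x) \<le> r" "norm (b - x) \<le> r" for a b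
    using lipschitz_onD[OF lip inb[OF that(1)] inb[OF that(2)]] by (simp add: j_def dist_norm)
  have jU: "j x + \<xi> \<bullet> (y - x) - e * norm (y - x) \<le> j y" if "y \<in> U" "norm (y - x) \<le> r" for y
    using r0(2)[OF that(1)] that r inb[of x] inb[of y] Jj by auto
  \<comment> \<open>Moving \<open>y\<close> to \<open>z\<close> changes
    \<open>j y - \<xi> \<bullet> (y - x)\<close> by at most \<open>M * norm (y - z)\<close>.\<close>
  define M where "M = L + norm \<xi>"
  have M0: "M \<ge> 0" unfolding M_def using L0 by simp
  \<comment> \<open>The quotients are chosen so that the bounds \<open>2 * M / i\<close> for
    \<open>norm (y - z)\<close> and \<open>2 * M\<^sup>2 / (e * i)\<close> for
    \<open>norm (z - x)\<close>, derived below, are less than \<open>r / 2\<close>. The minimiser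
    then stays off the boundary of the balls. The \<open>1\<close> makes this strict.\<close>
  define i where "i = 4 * M / r + 4 * M\<^sup>2 / (e * r) + 1"
  have i0: "i > 0" unfolding i_def using M0 e r by (auto intro!: add_nonneg_pos)
  have i1: "2 * M < i * (r / 2)" "2 * M\<^sup>2 < e * i * (r / 2)"
  proof -
    have "i * (r / 2) = 2 * M + (2 * M\<^sup>2 / e + r / 2)" "e * i * (r / 2) = 2 * M\<^sup>2 + (2 * M * e + e * r / 2)"
      unfolding i_def using r e by (auto simp: field_simps)
    moreover have "2 * M\<^sup>2 / e + r / 2 > 0" "2 * M * e + e * r / 2 > 0"
      using M0 e r by (auto intro!: add_nonneg_pos)
    ultimately show "2 * M < i * (r / 2)" "2 * M\<^sup>2 < e * i * (r / 2)" by linarith+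
  qed
  define \<phi> where "\<phi> = (\<lambda>(y, z). j y - \<xi> \<bullet> (y - x) + 2 * e * norm (z - x) + i / 2 * (norm (y - z))\<^sup>2)"
  let ?S = "cball x r \<times> (U \<inter> cball x r)"
  have "compact ?S" using U by (intro compact_Times) (auto intro: closed_Int_compact)
  moreover have "(x, x) \<in> ?S" using U r by auto
  moreover have "continuous_on ?S \<phi>"
  proof -
    have "continuous_on (ball x e0) j" using lipschitz_on_continuous_on[OF lip] by (simp add: j_def[abs_def])
    then have "continuous_on ?S (\<lambda>w. j (fst w))"
      by (rule continuous_on_compose2) (use r in \<open>auto intro: continuous_intros\<close>)
    then show ?thesis unfolding \<phi>_def case_prod_beta by (intro continuous_intros)
  qed
  ultimately obtain w where "w \<in> ?S" "\<forall>w'\<in>?S. \<phi> w \<le> \<phi> w'"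
    using continuous_attains_inf[of ?S \<phi>] by blast
  then obtain y z where yz: "norm (y - x) \<le> r" "z \<in> U" "norm (z - x) \<le> r"
    and "\<forall>w'\<in>?S. \<phi> (y, z) \<le> \<phi> w'"
    by (cases w) (auto simp: dist_norm norm_minus_commute)
  then have min: "\<phi> (y, z) \<le> \<phi> (y', z')" if "norm (y' - x) \<le> r" "z' \<in> U" "norm (z' - x) \<le> r" for y' z'
    using that by (auto simp: dist_norm norm_minus_commute)
  \<comment> \<open>The competitor \<open>(x, x)\<close> has the value \<open>j x\<close>. Applying
    the hypothesis at \<open>z\<close> consumes one of the two slack terms
    \<open>e * norm (z - x)\<close>; the other one remains on the left.\<close>
  have key: "e * norm (z - x) + i / 2 * (norm (y - z))\<^sup>2 \<le> M * norm (y - z)"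
  proof -
    have "\<phi> (y, z) \<le> j x" using min[of x x] U r by (simp add: \<phi>_def)
    moreover have "j z - L * norm (y - z) \<le> j y" using jL[of y z] yz by auto
    moreover have "\<xi> \<bullet> (y - z) \<le> norm \<xi> * norm (y - z)" by (rule norm_cauchy_schwarz)
    moreover have "\<xi> \<bullet> (y - z) = \<xi> \<bullet> (y - x) - \<xi> \<bullet> (z - x)" by (simp add: inner_diff_right)
    moreover note jU[OF yz(2,3)]
    ultimately show ?thesis unfolding \<phi>_def M_def by (simp add: algebra_simps)
  qed
  have d1: "i * norm (y - z) \<le> 2 * M"
  proof (cases "norm (y - z) = 0")
    case False
    have "i / 2 * norm (y - z) * norm (y - z) \<le> M * norm (y - z)"
      using key mult_nonneg_nonneg[OF less_imp_le[OF e] norm_ge_zero[of "z - x"]]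
      by (simp add: power2_eq_square mult.assoc)
    then show ?thesis using False by simp
  qed (use M0 in simp)
  have d2: "norm (y - z) < r / 2"
    using le_less_trans[OF d1 i1(1)] i0 by (simp only: mult_less_cancel_left_pos)
  have d3: "norm (z - x) < r / 2"
  proof -
    have "0 \<le> i / 2 * (norm (y - z))\<^sup>2" using i0 by simp
    then have "e * norm (z - x) \<le> M * norm (y - z)" using key by linarith
    then have "i * (e * norm (z - x)) \<le> i * (M * norm (y - z))" using i0 by simp
    also have "\<dots> \<le> M * (2 * M)" using mult_left_mono[OF d1 M0] by (simp add: algebra_simps)
    also have "\<dots> < e * i * (r / 2)" using i1(2) by (simp add: power2_eq_square)
    finally have "(e * i) * norm (z - x) < (e * i) * (r / 2)" by (simp add: algebra_simps)
    then show ?thesis using e i0 by (simp add: mult_less_cancel_left_pos)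
  qed
  have d4: "norm (y - x) < r"
    using norm_triangle_ineq[of "y - z" "z - x"] d2 d3 by simp
  \<comment> \<open>Optimality of \<open>\<phi>\<close> in \<open>y\<close> with \<open>z\<close>
    fixed dictates this vector: the penalty has gradient \<open>i *\<^sub>R (y - z)\<close>
    there.\<close>
  define \<eta> where "\<eta> = \<xi> - i *\<^sub>R (y - z)"
  have "\<eta> \<in> regular_subdiff J y"
  proof (rule regular_subdiffI)
    show "\<bar>J y\<bar> \<noteq> \<infinity>" by (rule fin[OF inb[OF yz(1)]])
    fix c :: real assume c: "c > 0"
    \<comment> \<open>The first radius keeps \<open>y'\<close> in the ball of minimisation; the
      second makes the quadratic part of the penalty at most
      \<open>c * norm (y' - y)\<close>.\<close>
    have "\<forall>\<^sub>F y' in at y. dist y' y < min (r - norm (y - x)) (2 * c / i)"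
      unfolding eventually_at using d4 c i0
      by (intro exI[of _ "min (r - norm (y - x)) (2 * c / i)"]) auto
    then show "\<forall>\<^sub>F y' in at y. J y + ereal (\<eta> \<bullet> (y' - y) - c * norm (y' - y)) \<le> J y'"
    proof eventually_elim
      case (elim y')
      have y': "norm (y' - x) \<le> r"
        using elim norm_triangle_ineq[of "y' - y" "y - x"] by (simp add: dist_norm)
      have "i * norm (y' - y) \<le> 2 * c" using elim i0 by (simp add: dist_norm field_simps)
      then have 1: "i / 2 * (norm (y' - y))\<^sup>2 \<le> c * norm (y' - y)"
        using mult_right_mono[of "i * norm (y' - y)" "2 * c" "norm (y' - y)"]
        by (simp add: power2_eq_square)
      have 2: "(norm (y' - z))\<^sup>2 = (norm (y - z))\<^sup>2 + 2 * ((y - z) \<bullet> (y' - y)) + (norm (y' - y))\<^sup>2"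
        using dot_norm[of "y - z" "y' - y"] by (simp add: field_simps)
      have "i / 2 * (norm (y' - z))\<^sup>2 = i / 2 * (norm (y - z))\<^sup>2 + i * ((y - z) \<bullet> (y' - y)) + i / 2 * (norm (y' - y))\<^sup>2"
        unfolding 2 by (simp add: algebra_simps)
      moreover have "\<phi> (y, z) \<le> \<phi> (y', z)" by (rule min[OF y' yz(2,3)])
      moreover have "\<eta> \<bullet> (y' - y) = \<xi> \<bullet> (y' - x) - \<xi> \<bullet> (y - x) - i * ((y - z) \<bullet> (y' - y))"
        unfolding \<eta>_def by (simp add: inner_diff_left inner_diff_right right_diff_distrib)
      ultimately have "j y + (\<eta> \<bullet> (y' - y) - c * norm (y' - y)) \<le> j y'"
        using 1 unfolding \<phi>_def case_prod_conv by linarith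
      then show ?case using Jj[OF inb[OF y']] Jj[OF inb[OF yz(1)]] by simp
    qed
  qed
  moreover have "norm \<eta> \<le> 3 * norm \<xi> + 2 * L"
    using norm_triangle_ineq4[of \<xi> "i *\<^sub>R (y - z)"] d1 i0 unfolding \<eta>_def M_def by simp
  \<comment> \<open>Now \<open>y\<close> is fixed and \<open>z\<close> moves a fraction
    \<open>t\<close> towards \<open>z'\<close>, inside \<open>U\<close> by convexity. After division
    by \<open>t\<close> the second-order part of the penalty still carries a factor \<open>t\<close>
    and vanishes in the limit.\<close>
  moreover have "(\<xi> - \<eta>) \<bullet> (z' - z) \<le> 2 * e * norm (z' - z)" if z': "z' \<in> U" for z'
  proof -
    let ?g = "\<lambda>t. 2 * e * norm (z' - z) + t * (i / 2 * (norm (z' - z))\<^sup>2)"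
    have "(?g \<longlongrightarrow> 2 * e * norm (z' - z) + 0 * (i / 2 * (norm (z' - z))\<^sup>2)) (at_right 0)"
      by (intro tendsto_intros)
    moreover have "\<forall>\<^sub>F t in at_right 0. (\<xi> - \<eta>) \<bullet> (z' - z) \<le> ?g t"
    proof -
      \<comment> \<open>Since \<open>norm (z - x) < r / 2\<close>, a displacement of length at most
        \<open>r / 2\<close> remains in the ball; the \<open>1\<close> in the denominator covers
        \<open>z' = z\<close>.\<close>
      define s where "s = min 1 (r / 2 / (norm (z' - z) + 1))"
      have n: "norm (z' - z) + 1 > 0" by (smt (verit) norm_ge_zero)
      have s: "s > 0" unfolding s_def using r n by simp
      have "\<forall>\<^sub>F t in at_right 0. 0 < t \<and> t < s"
        using s eventually_at_right[of 0 s] by (auto simp: eventually_at_right_field)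
      then show ?thesis
      proof eventually_elim
        case (elim t)
        have "t \<le> 1" "t \<le> r / 2 / (norm (z' - z) + 1)" using elim unfolding s_def by auto
        then have "t * norm (z' - z) \<le> r / 2"
          using n elim by (simp add: field_simps)
        let ?z = "z + t *\<^sub>R (z' - z)"
        have "?z = (1 - t) *\<^sub>R z + t *\<^sub>R z'" by (simp add: algebra_simps)
        then have zU: "?z \<in> U" using convexD_alt[OF U(2) yz(2) z'] elim \<open>t \<le> 1\<close> by auto
        have 1: "norm (?z - x) \<le> norm (z - x) + t * norm (z' - z)"
          using norm_triangle_ineq[of "z - x" "t *\<^sub>R (z' - z)"] elim by (simp add: diff_add_eq)
        then have zr: "norm (?z - x) \<le> r" using d3 \<open>t * _ \<le> r / 2\<close> by linarith
        have "(norm (y - ?z))\<^sup>2 = (norm (y - z))\<^sup>2 - 2 * (t * ((y - z) \<bullet> (z' - z))) + (t * norm (z' - z))\<^sup>2"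
          using power2_norm_diff[of "y - z" "t *\<^sub>R (z' - z)"]
          by (simp add: diff_diff_eq power_mult_distrib)
        then have 2: "i / 2 * (norm (y - ?z))\<^sup>2 =
            i / 2 * (norm (y - z))\<^sup>2 - t * (i * ((y - z) \<bullet> (z' - z))) + t * (t * (i / 2 * (norm (z' - z))\<^sup>2))"
          by (simp only:) (simp add: right_diff_distrib distrib_left power2_eq_square)
        have 3: "2 * e * norm (?z - x) \<le> 2 * e * norm (z - x) + t * (2 * e * norm (z' - z))"
          using mult_left_mono[OF 1, of "2 * e"] e by (simp add: algebra_simps)
        have "t * (i * ((y - z) \<bullet> (z' - z))) \<le> t * ?g t"
          using min[OF yz(1) zU zr] 2 3 unfolding \<phi>_def case_prod_conv distrib_left by linarith
        then show ?case using elim unfolding \<eta>_def by simp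
      qed
    qed
    ultimately show ?thesis
      using tendsto_lowerbound[of ?g _ "at_right 0" "(\<xi> - \<eta>) \<bullet> (z' - z)"] by simp
  qed
  ultimately show ?thesis
    using d3 d4 r inb[OF yz(1)] by (intro exI[of _ y] exI[of _ z] exI[of _ \<eta>]) auto
qed

text \<open>The fuzzy rule is applied with slack \<open>inverse (real (Suc n))\<close>. Its uniform
  norm bound gives a convergent subsequence of subgradients, Lipschitz continuity gives the
  convergence of values that limiting subgradients require, and the slack in the normal cone
  inequality tends to 0.\<close>

lemma limiting_sum_rule_normal_cone:
  fixes J :: "'a::euclidean_space \<Rightarrow> ereal"
  assumes U: "closed U" "convex U" "x \<in> U"
    and lip: "lipschitz_around J x"
    and sub: "\<And>e::real. e > 0 \<Longrightarrow> \<exists>r>0. \<forall>y\<in>U. norm (y - x) \<le> r \<longrightarrow>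
                J x + ereal (\<xi> \<bullet> (y - x) - e * norm (y - x)) \<le> J y"
  shows "\<exists>\<eta>\<in>limiting_subdiff J x. \<xi> - \<eta> \<in> normal_cone U x"
proof -
  obtain e0 L where e0: "e0 > 0" and fin': "\<forall>y\<in>ball x e0. \<bar>J y\<bar> \<noteq> \<infinity>"
    and L: "L-lipschitz_on (ball x e0) (\<lambda>y. real_of_ereal (J y))"
    using lip unfolding lipschitz_around_def by blast
  note fin = fin'[rule_format]
  have "\<forall>n. \<exists>y z \<eta>. norm (y - x) < inverse (real (Suc n)) \<and> y \<in> ball x e0 \<and> norm (z - x) < inverse (real (Suc n)) \<and>
      \<eta> \<in> regular_subdiff J y \<and> norm \<eta> \<le> 3 * norm \<xi> + 2 * L \<and>
      (\<forall>z'\<in>U. (\<xi> - \<eta>) \<bullet> (z' - z) \<le> 2 * inverse (real (Suc n)) * norm (z' - z))"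
    by (intro allI fuzzy_sum_rule[OF U fin e0 L sub]) auto
  then obtain Y Z N where Y: "\<And>n. norm (Y n - x) < inverse (real (Suc n))" "\<And>n. Y n \<in> ball x e0"
    and Z: "\<And>n. norm (Z n - x) < inverse (real (Suc n))"
    and N: "\<And>n. N n \<in> regular_subdiff J (Y n)" "\<And>n. norm (N n) \<le> 3 * norm \<xi> + 2 * L"
    and ineq: "\<And>n z'. z' \<in> U \<Longrightarrow> (\<xi> - N n) \<bullet> (z' - Z n) \<le> 2 * inverse (real (Suc n)) * norm (z' - Z n)"
    by metis
  have lim: "W \<longlonglongrightarrow> x" if "\<And>n. norm (W n - x) < inverse (real (Suc n))" for W
  proof -
    have "(\<lambda>n. W n - x) \<longlonglongrightarrow> 0"
      by (rule Lim_null_comparison[OF always_eventually LIMSEQ_inverse_real_of_nat])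
        (intro allI less_imp_le that)
    then show ?thesis by (rule LIM_zero_cancel)
  qed
  have "compact (cball 0 (3 * norm \<xi> + 2 * L) :: 'a set)" by simp
  moreover have "\<forall>n. N n \<in> cball 0 (3 * norm \<xi> + 2 * L)" using N(2) by simp
  ultimately obtain \<eta> \<rho> where \<rho>: "strict_mono \<rho>" "(N \<circ> \<rho>) \<longlonglongrightarrow> \<eta>"
    unfolding compact_def by blast
  note s = LIMSEQ_subseq_LIMSEQ[OF _ \<rho>(1)]
  have Yl: "(Y \<circ> \<rho>) \<longlonglongrightarrow> x" and Zl: "(Z \<circ> \<rho>) \<longlonglongrightarrow> x"
    by (intro s lim Y Z)+
  have "continuous_on (ball x e0) (\<lambda>y. real_of_ereal (J y))"
    by (rule lipschitz_on_continuous_on[OF L])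
  then have "isCont (\<lambda>y. real_of_ereal (J y)) x"
    using e0 by (simp add: continuous_on_eq_continuous_at)
  then have "(\<lambda>n. real_of_ereal (J ((Y \<circ> \<rho>) n))) \<longlonglongrightarrow> real_of_ereal (J x)"
    using Yl by (rule isCont_tendsto_compose)
  then have "(\<lambda>n. ereal (real_of_ereal (J ((Y \<circ> \<rho>) n)))) \<longlonglongrightarrow> ereal (real_of_ereal (J x))"
    by simp
  then have "(\<lambda>n. J ((Y \<circ> \<rho>) n)) \<longlonglongrightarrow> J x"
    using fin Y(2) e0 by (simp add: ereal_real')
  then have "\<eta> \<in> limiting_subdiff J x"
    using fin[of x] e0 Yl \<rho> N(1)
    by (intro limiting_subdiffI[where X = "Y \<circ> \<rho>" and N = "N \<circ> \<rho>"]) auto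
  moreover have "(\<xi> - \<eta>) \<bullet> (z' - x) \<le> 0" if "z' \<in> U" for z'
  proof (rule tendsto_le[OF sequentially_bot])
    show "(\<lambda>n. (\<xi> - (N \<circ> \<rho>) n) \<bullet> (z' - (Z \<circ> \<rho>) n)) \<longlonglongrightarrow> (\<xi> - \<eta>) \<bullet> (z' - x)"
      by (intro tendsto_intros \<rho> Zl)
    have "(\<lambda>n. 2 * ((\<lambda>n. inverse (real (Suc n))) \<circ> \<rho>) n * norm (z' - (Z \<circ> \<rho>) n)) \<longlonglongrightarrow> 2 * 0 * norm (z' - x)"
      by (intro tendsto_intros s[OF LIMSEQ_inverse_real_of_nat] Zl)
    then show "(\<lambda>n. 2 * inverse (real (Suc (\<rho> n))) * norm (z' - Z (\<rho> n))) \<longlonglongrightarrow> 0" by simp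
  qed (use ineq[OF that] in simp)
  ultimately show ?thesis unfolding normal_cone_def by blast
qed

text \<open>The case split reflects the constraint qualification: without a constraint the normal cone is
  trivial and \<open>J\<close> may be merely extended-real-valued.\<close>

lemma first_order_condition:
  fixes J :: "'a::euclidean_space \<Rightarrow> ereal"
  assumes U: "closed U" "convex U" "x \<in> U" and fin: "\<bar>J x\<bar> \<noteq> \<infinity>"
    and lip: "U \<noteq> UNIV \<Longrightarrow> lipschitz_around J x"
    and D: "(f has_derivative (\<lambda>h. g \<bullet> h)) (at x)"
    and min: "\<And>y. y \<in> U \<Longrightarrow> J x + ereal (f x) \<le> J y + ereal (f y)"
  shows "\<exists>\<xi>\<in>limiting_subdiff J x. \<exists>\<zeta>\<in>normal_cone U x. g + \<xi> + \<zeta> = 0"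
proof -
  obtain c where c: "J x = ereal c" using fin by auto
  \<comment> \<open>Minimality and the expansion of \<open>f\<close> at \<open>x\<close> make
    \<open>- g\<close> a regular subgradient of \<open>J\<close> restricted to
    \<open>U\<close>.\<close>
  have ev: "\<exists>r>0. \<forall>y. norm (y - x) < r \<longrightarrow> y \<in> U \<longrightarrow>
      J x + ereal ((- g) \<bullet> (y - x) - e * norm (y - x)) \<le> J y" if "e > 0" for e :: real
  proof -
    obtain r where r: "r > 0" "\<And>y. norm (y - x) < r \<Longrightarrow> norm (f y - f x - g \<bullet> (y - x)) \<le> e * norm (y - x)"
      using D \<open>e > 0\<close> unfolding has_derivative_at_alt by metis
    show ?thesis
    proof (intro exI[of _ r] conjI allI impI r(1))
      fix y assume "norm (y - x) < r" "y \<in> U"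
      then show "J x + ereal ((- g) \<bullet> (y - x) - e * norm (y - x)) \<le> J y"
        using r(2)[of y] min[of y] c by (cases "J y") (auto simp: abs_le_iff)
    qed
  qed
  show ?thesis
  proof (cases "U = UNIV")
    case True
    have "- g \<in> regular_subdiff J x"
      using ev True by (intro regular_subdiffI fin) (auto simp: eventually_at dist_norm, blast)
    then show ?thesis
      using regular_subdiff_subset_limiting[of J x]
      by (intro bexI[of _ "- g"] bexI[of _ 0]) (auto simp: normal_cone_def)
  next
    case False
    have "\<exists>r>0. \<forall>y\<in>U. norm (y - x) \<le> r \<longrightarrow>
        J x + ereal ((- g) \<bullet> (y - x) - e * norm (y - x)) \<le> J y" if e: "e > 0" for e :: real
    proof -
      obtain r where "r > 0" "\<forall>y. norm (y - x) < r \<longrightarrow> y \<in> U \<longrightarrow>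
          J x + ereal ((- g) \<bullet> (y - x) - e * norm (y - x)) \<le> J y" using ev[OF e] by blast
      \<comment> \<open>Halving passes from the open ball to the closed ball of the sum
        rule.\<close>
      then show ?thesis by (intro exI[of _ "r / 2"]) auto
    qed
    then obtain \<eta> where "\<eta> \<in> limiting_subdiff J x" "- g - \<eta> \<in> normal_cone U x"
      using limiting_sum_rule_normal_cone[OF U lip[OF False], of "- g"] by blast
    then show ?thesis by (intro bexI[of _ \<eta>] bexI[of _ "- g - \<eta>"]) auto
  qed
qed

section \<open>One step of the algorithm\<close>

lemma inner_transpose_mult:
  fixes A :: "real^'n^'m"
  shows "(transpose A *v y) \<bullet> x = y \<bullet> (A *v x)"
  by (simp add: transpose_matrix_vector dot_lmul_matrix)

lemma transpose_diff_mult: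
  fixes A A' :: "real^'n^'m"
  shows "transpose (A - A') *v y = transpose A *v y - transpose A' *v y"
  by (simp add: vec_eq_iff transpose_def matrix_vector_mult_def sum_subtractf left_diff_distrib)

lemma jacobian_add:
  fixes f g :: "real^'n \<Rightarrow> real^'m"
  assumes "f differentiable (at x)" "g differentiable (at x)"
  shows "jacobian (\<lambda>x. f x + g x) (at x) = jacobian f (at x) + jacobian g (at x)"
proof -
  have "((\<lambda>x. f x + g x) has_derivative (\<lambda>h. jacobian f (at x) *v h + jacobian g (at x) *v h)) (at x)"
    using assms by (intro has_derivative_add) (simp_all add: jacobian_works)
  moreover have "((\<lambda>x. f x + g x) has_derivative (*v) (jacobian (\<lambda>x. f x + g x) (at x))) (at x)"
    using assms by (simp add: jacobian_works[symmetric])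
  ultimately have "(*v) (jacobian (\<lambda>x. f x + g x) (at x)) = (\<lambda>h. jacobian f (at x) *v h + jacobian g (at x) *v h)"
    using has_derivative_unique by blast
  then show ?thesis
    by (simp add: matrix_eq matrix_vector_mult_add_rdistrib fun_eq_iff)
qed

lemma norm_spectral_norm: "norm (B *v x) \<le> spectral_norm B * norm x"
  unfolding spectral_norm_def by (rule onorm) (rule matrix_vector_mul_bounded_linear)

lemma spectral_norm_nonneg: "0 \<le> spectral_norm B"
  unfolding spectral_norm_def by (rule onorm_pos_le) (rule matrix_vector_mul_bounded_linear)

section \<open>Estimates depending on the problem data alone\<close>

locale napp_problem =
  fixes U :: "(real^'n) set"
    and G :: "(real^'n) \<times> (real^'d) \<Rightarrow> real"
    and J :: "real^'n \<Rightarrow> ereal"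
    and H :: "real^'d \<Rightarrow> real"
    and \<Omega> \<Phi> :: "real^'n \<Rightarrow> real^'m"
    and B :: "real^'d^'m"
    and K :: "real^'n \<Rightarrow> real"
    and L_G L_H L\<^sub>\<Theta> L_K \<gamma> :: real
    and L_\<Omega>j :: "'m \<Rightarrow> real"
  assumes U: "closed U" "convex U"
    and diff: "\<Omega> differentiable_on UNIV" "\<Phi> differentiable_on UNIV"
    and G: "lipschitz_gradient L_G G"
    and H: "lipschitz_gradient L_H H"
    and J: "proper J" "U \<noteq> UNIV \<Longrightarrow> \<forall>x \<in> edom J \<inter> U. lipschitz_around J x"
    and Theta_lipschitz: "\<forall>x x'. norm (\<Omega> x + \<Phi> x - (\<Omega> x' + \<Phi> x')) \<le> L\<^sub>\<Theta> * norm (x - x')"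
    and Omega: "\<forall>j. lipschitz_gradient (L_\<Omega>j j) (\<lambda>x. \<Omega> x $ j)"
    and K: "lipschitz_gradient L_K K"
    and gamma: "\<gamma> > 0"
begin

abbreviation "\<Theta> \<equiv> \<lambda>x. \<Omega> x + \<Phi> x"
abbreviation "L_\<Omega> \<equiv> \<Sum>j\<in>UNIV. L_\<Omega>j j"
abbreviation "\<rho> \<equiv> L\<^sub>\<Theta> + spectral_norm B"
abbreviation "\<L> \<equiv> aug_lagrangian G J H \<Theta> B \<gamma>"
abbreviation "subdiff_L \<equiv> aug_lagrangian_subdiff U G J H \<Theta> B \<gamma>"

text \<open>The three summands belong to the \<open>u\<close>, \<open>v\<close> and \<open>p\<close>
  blocks of the subgradient. \<open>Q\<close> bounds the old multiplier estimate and
  \<open>E\<close> bounds \<open>1 / \<epsilon> k\<close>, so the constant is free of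
  \<open>k\<close>.\<close>

definition residual_bound :: "real \<Rightarrow> real \<Rightarrow> real" where
  "residual_bound Q E = (L_G + L\<^sub>\<Theta> * (1 + \<gamma> * \<rho>) + L_\<Omega> * Q + E * L_K)
     + (L_G + L_H + spectral_norm B * (1 + \<gamma> * \<rho>) + \<gamma> * (spectral_norm B)\<^sup>2) + 1 / \<gamma>"

text \<open>\<open>M\<close> is the ratio of the competitor's distance from the new iterate to the
  step length \<open>d\<close>. The factor \<open>1 + (1 + M)\<^sup>2\<close> collects Taylor errors
  at distances \<open>d\<close> and \<open>(1 + M) * d\<close> from the old iterate; the other terms
  come from the \<open>v\<close>-step, the multiplier update and the penalty.\<close>

definition value_bound :: "real \<Rightarrow> real \<Rightarrow> real \<Rightarrow> real" where
  "value_bound Q E M = (L_G + L_H + Q * L_\<Omega> + E * L_K) * (1 + (1 + M)\<^sup>2)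
     + \<gamma> * (spectral_norm B)\<^sup>2 * M + \<rho> + 1 / (2 * \<gamma>)"

lemma nonneg: "0 \<le> L_G" "0 \<le> L_H" "0 \<le> L_K" "0 \<le> L_\<Omega>j j" "0 \<le> L_\<Omega>" "0 \<le> L\<^sub>\<Theta>" "0 \<le> \<rho>"
proof -
  show "0 \<le> L_G" "0 \<le> L_H" "0 \<le> L_K" and *: "\<And>j. 0 \<le> L_\<Omega>j j"
    using lipschitz_gradient_nonneg G H K Omega by blast+
  show "0 \<le> L_\<Omega>" by (intro sum_nonneg *)
  \<comment> \<open>Two points at distance 1 force the Lipschitz constant to be nonnegative.\<close>
  have "norm (axis undefined 1 - 0 :: real^'n) = 1" by (simp add: norm_axis_1)
  then show "0 \<le> L\<^sub>\<Theta>"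
    using order.trans[OF norm_ge_zero Theta_lipschitz[rule_format, of "axis undefined 1" 0]] by simp
  then show "0 \<le> \<rho>" using spectral_norm_nonneg[of B] by simp
qed

lemma residual_lipschitz:
  "norm (\<Theta> x + B *v y - (\<Theta> x' + B *v y')) \<le> \<rho> * norm ((x, y) - (x', y'))"
proof -
  have "norm (\<Theta> x + B *v y - (\<Theta> x' + B *v y')) \<le> norm (\<Theta> x - \<Theta> x') + norm (B *v (y - y'))"
    using norm_triangle_ineq[of "\<Theta> x - \<Theta> x'" "B *v (y - y')"]
    by (simp add: matrix_vector_mult_diff_distrib algebra_simps)
  also have "\<dots> \<le> L\<^sub>\<Theta> * norm (x - x') + spectral_norm B * norm (y - y')"
    using Theta_lipschitz norm_spectral_norm[of B "y - y'"] by (intro add_mono) auto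
  also have "\<dots> \<le> L\<^sub>\<Theta> * norm ((x, y) - (x', y')) + spectral_norm B * norm ((x, y) - (x', y'))"
    using nonneg spectral_norm_nonneg[of B]
      norm_fst_le[where x = "x - x'" and y = "y - y'"] norm_snd_le[where x = "x - x'" and y = "y - y'"]
    by (intro add_mono mult_left_mono) auto
  finally show ?thesis by (simp add: algebra_simps)
qed

text \<open>Used for consecutive iterates, and for an iterate against \<open>wbar\<close>, where it
  bounds \<open>q k\<close>.\<close>

lemma multiplier_lipschitz:
  "norm (multiplier_estimate \<Theta> B \<gamma> x y s - multiplier_estimate \<Theta> B \<gamma> x' y' s')
    \<le> (1 + \<gamma> * \<rho>) * norm ((x, y, s) - (x', y', s'))"
proof -
  let ?d = "norm ((x, y, s) - (x', y', s'))"
  have "norm ((x, y) - (x', y')) \<le> ?d"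
    by (simp add: norm_Pair)
  then have "norm (\<Theta> x + B *v y - (\<Theta> x' + B *v y')) \<le> \<rho> * ?d"
    using nonneg by (intro order.trans[OF residual_lipschitz] mult_left_mono)
  then have "norm (\<gamma> *\<^sub>R (\<Theta> x + B *v y - (\<Theta> x' + B *v y'))) \<le> \<gamma> * (\<rho> * ?d)"
    using gamma by simp
  moreover have "norm (s - s') \<le> ?d"
    using norm_snd_le[where x = "y - y'" and y = "s - s'"] norm_snd_le[where x = "x - x'" and y = "(y - y', s - s')"]
    by simp
  moreover have eq: "multiplier_estimate \<Theta> B \<gamma> x y s - multiplier_estimate \<Theta> B \<gamma> x' y' s'
      = (s - s') + \<gamma> *\<^sub>R (\<Theta> x + B *v y - (\<Theta> x' + B *v y'))"
    unfolding multiplier_estimate_def by (simp add: scaleR_diff_right)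
  ultimately show ?thesis
    using norm_triangle_ineq[of "s - s'" "\<gamma> *\<^sub>R (\<Theta> x + B *v y - (\<Theta> x' + B *v y'))"]
    by (simp only: eq distrib_right mult_1_left mult.assoc)
qed

text \<open>The rows of the Jacobian are the component gradients; estimating by the l1 norm adds up
  their constants.\<close>

lemma jacobian_Omega_lipschitz:
  "norm ((jacobian \<Omega> (at x) - jacobian \<Omega> (at y)) *v h) \<le> L_\<Omega> * norm (x - y) * norm h"
proof -
  have d: "\<Omega> differentiable (at z)" for z
    using diff(1) by (simp add: differentiable_on_def)
  have "norm ((jacobian \<Omega> (at x) - jacobian \<Omega> (at y)) *v h)
      \<le> (\<Sum>j\<in>UNIV. \<bar>((jacobian \<Omega> (at x) - jacobian \<Omega> (at y)) *v h) $ j\<bar>)"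
    by (rule norm_le_l1_cart)
  also have "\<dots> \<le> (\<Sum>j\<in>UNIV. L_\<Omega>j j * norm (x - y) * norm h)"
  proof (rule sum_mono)
    fix j
    have "((jacobian \<Omega> (at x) - jacobian \<Omega> (at y)) *v h) $ j
        = (grad (\<lambda>x. \<Omega> x $ j) x - grad (\<lambda>x. \<Omega> x $ j) y) \<bullet> h"
      by (simp add: matrix_vector_mult_diff_rdistrib inner_diff_left jacobian_mult_component d)
    moreover have "norm (grad (\<lambda>x. \<Omega> x $ j) x - grad (\<lambda>x. \<Omega> x $ j) y) \<le> L_\<Omega>j j * norm (x - y)"
      using Omega by (intro lipschitz_gradient_norm_diff) blast
    ultimately show "\<bar>((jacobian \<Omega> (at x) - jacobian \<Omega> (at y)) *v h) $ j\<bar> \<le> L_\<Omega>j j * norm (x - y) * norm h"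
      by (simp only:) (intro order.trans[OF Cauchy_Schwarz_ineq2] mult_right_mono norm_ge_zero)
  qed
  finally show ?thesis by (simp add: sum_distrib_right)
qed

lemma Omega_taylor:
  "\<bar>q \<bullet> (\<Omega> y - \<Omega> x - jacobian \<Omega> (at x) *v (y - x))\<bar> \<le> norm q * (L_\<Omega> * (norm (y - x))\<^sup>2)"
proof -
  have d: "\<Omega> differentiable (at x)"
    using diff(1) by (simp add: differentiable_on_def)
  have "norm (\<Omega> y - \<Omega> x - jacobian \<Omega> (at x) *v (y - x))
      \<le> (\<Sum>j\<in>UNIV. \<bar>(\<Omega> y - \<Omega> x - jacobian \<Omega> (at x) *v (y - x)) $ j\<bar>)"
    by (rule norm_le_l1_cart)
  also have "\<dots> \<le> (\<Sum>j\<in>UNIV. L_\<Omega>j j * (norm (y - x))\<^sup>2)"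
    using lipschitz_gradient_taylor[OF Omega[rule_format], where x = x and y = y]
    by (intro sum_mono) (simp add: jacobian_mult_component d)
  finally have "norm (\<Omega> y - \<Omega> x - jacobian \<Omega> (at x) *v (y - x)) \<le> L_\<Omega> * (norm (y - x))\<^sup>2"
    by (simp add: sum_distrib_right)
  then show ?thesis
    by (intro order.trans[OF Cauchy_Schwarz_ineq2] mult_left_mono) auto
qed

end

section \<open>Optimality conditions of one iteration and the resulting subgradient\<close>

locale napp_step = napp_problem U G J H \<Omega> \<Phi> B K L_G L_H L\<^sub>\<Theta> L_K \<gamma> L_\<Omega>j
  for U :: "(real^'n) set"
    and G :: "(real^'n) \<times> (real^'d) \<Rightarrow> real"
    and J :: "real^'n \<Rightarrow> ereal"
    and H :: "real^'d \<Rightarrow> real"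
    and \<Omega> \<Phi> :: "real^'n \<Rightarrow> real^'m"
    and B :: "real^'d^'m"
    and K :: "real^'n \<Rightarrow> real"
    and L_G L_H L\<^sub>\<Theta> L_K \<gamma> :: real
    and L_\<Omega>j :: "'m \<Rightarrow> real" +
  fixes u u' :: "real^'n" and v v' :: "real^'d" and p p' q :: "real^'m" and e Q E :: real
  assumes q: "q = multiplier_estimate \<Theta> B \<gamma> u v p"
    and e: "e > 0" "1 / e \<le> E"
    and Q: "norm q \<le> Q"
    and finite: "\<bar>J u'\<bar> \<noteq> \<infinity>"
    and u_min: "is_arg_min
           (\<lambda>x. ereal (grad1 G u v \<bullet> x) + J x
                + ereal (q \<bullet> (jacobian \<Omega> (at u) *v x + \<Phi> x) + 1 / e * bregman K x u))
           (\<lambda>x. x \<in> U) u'"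
    and v_min: "is_arg_min
           (\<lambda>y. (grad2 G u v + grad H v) \<bullet> y + q \<bullet> (B *v y) + \<gamma> / 2 * (norm (B *v (y - v)))\<^sup>2)
           (\<lambda>y. True) v'"
    and p': "p' = p + \<gamma> *\<^sub>R (\<Theta> u' + B *v v')"
begin

abbreviation "d \<equiv> norm ((u, v, p) - (u', v', p'))"
abbreviation "q' \<equiv> multiplier_estimate \<Theta> B \<gamma> u' v' p'"

lemma norm_step_le: "norm (u' - u) \<le> d" "norm (v' - v) \<le> d" "norm (p' - p) \<le> d"
    "norm ((u', v') - (u, v)) \<le> d"
proof -
  have "norm (v' - v, p' - p) \<le> norm (u' - u, v' - v, p' - p)" by (rule norm_snd_le)
  moreover have "d = norm (u' - u, v' - v, p' - p)"
    using norm_minus_commute[of "(u, v, p)" "(u', v', p')"] by simp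
  ultimately show "norm (u' - u) \<le> d" "norm (v' - v) \<le> d" "norm (p' - p) \<le> d"
    using norm_fst_le[where x = "u' - u" and y = "(v' - v, p' - p)"]
      norm_fst_le[where x = "v' - v" and y = "p' - p"] norm_snd_le[where x = "v' - v" and y = "p' - p"] by auto
  show "norm ((u', v') - (u, v)) \<le> d"
    by (simp add: norm_Pair norm_minus_commute)
qed

lemma bounds_nonneg: "0 \<le> E" "0 \<le> Q"
  using e order.trans[OF norm_ge_zero Q] by (auto intro: order.trans[of 0 "1 / e"])

lemma u'_in_U: "u' \<in> U"
  using u_min by (simp add: is_arg_min_def)

lemma v_stationary:
  "grad2 G u v + grad H v + transpose B *v q + \<gamma> *\<^sub>R (transpose B *v (B *v (v' - v))) = 0"
    (is "?g = 0")
proof -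
  let ?f = "\<lambda>y. (grad2 G u v + grad H v) \<bullet> y + q \<bullet> (B *v y) + \<gamma> / 2 * ((B *v (y - v)) \<bullet> (B *v (y - v)))"
  have lin: "((\<lambda>y. B *v f y) has_derivative (\<lambda>h. B *v f' h)) F" if "(f has_derivative f') F" for f f' F
    by (rule bounded_linear.has_derivative[OF matrix_vector_mul_bounded_linear that])
  have "(?f has_derivative (\<lambda>h. ?g \<bullet> h)) (at v')"
    by (rule derivative_eq_intros lin refl)+
      (simp add: fun_eq_iff inner_add_left inner_transpose_mult inner_commute[of "B *v (v' - v)"] del: transpose_matrix_vector)
  moreover have "\<forall>\<^sub>F y in at v'. ?f v' \<le> ?f y"
    using v_min by (intro always_eventually) (auto simp: is_arg_min_def not_less power2_norm_eq_inner)
  ultimately have "(\<lambda>h. ?g \<bullet> h) = (\<lambda>h. 0)"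
    by (rule has_derivative_local_min)
  then have "?g \<bullet> ?g = 0" by (rule fun_cong)
  then show ?thesis by simp
qed

text \<open>Infeasibility of the new iterate is thereby of order \<open>d\<close>. This bounds the
  third block of the subgradient and makes the penalty term quadratic in \<open>d\<close>.\<close>

lemma primal_residual: "\<Theta> u' + B *v v' = (1 / \<gamma>) *\<^sub>R (p' - p)"
  using p' gamma by simp

lemma norm_multiplier_diff: "norm (q' - q) \<le> (1 + \<gamma> * \<rho>) * d"
  using multiplier_lipschitz[of u' v' p' u v p] unfolding q by (simp only: norm_minus_commute)

lemma u_min_real:
  assumes "x \<in> U"
  shows "J u' + ereal (grad1 G u v \<bullet> u' + (q \<bullet> (jacobian \<Omega> (at u) *v u' + \<Phi> u') + 1 / e * bregman K u' u))
    \<le> J x + ereal (grad1 G u v \<bullet> x + (q \<bullet> (jacobian \<Omega> (at u) *v x + \<Phi> x) + 1 / e * bregman K x u))"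
proof -
  have *: "ereal a + y + ereal b = y + ereal (a + b)" for a b y by (cases y) auto
  show ?thesis using u_min assms by (auto simp: is_arg_min_def not_less *)
qed

text \<open>The subproblem linearises \<open>\<Omega>\<close> at \<open>u\<close> but keeps
  \<open>\<Phi>\<close> exact, so the Jacobian of \<open>\<Phi>\<close> appears already at
  \<open>u'\<close>. Hence only the Jacobian of \<open>\<Omega>\<close> has to be compared at two
  points.\<close>

lemma u_stationary:
  obtains \<xi> \<zeta> where "\<xi> \<in> limiting_subdiff J u'" "\<zeta> \<in> normal_cone U u'"
    "grad1 G u v + transpose (jacobian \<Omega> (at u)) *v q + transpose (jacobian \<Phi> (at u')) *v q
       + (1 / e) *\<^sub>R (grad K u' - grad K u) + \<xi> + \<zeta> = 0"
proof -
  let ?f = "\<lambda>x. grad1 G u v \<bullet> x + (q \<bullet> (jacobian \<Omega> (at u) *v x + \<Phi> x) + 1 / e * bregman K x u)"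
  let ?g = "grad1 G u v + transpose (jacobian \<Omega> (at u)) *v q + transpose (jacobian \<Phi> (at u')) *v q
       + (1 / e) *\<^sub>R (grad K u' - grad K u)"
  have lin: "((*v) (jacobian \<Omega> (at u)) has_derivative (*v) (jacobian \<Omega> (at u))) (at u')"
    by (rule bounded_linear.has_derivative[OF matrix_vector_mul_bounded_linear has_derivative_ident])
  have Phi: "(\<Phi> has_derivative (*v) (jacobian \<Phi> (at u'))) (at u')"
    using diff(2) by (simp add: jacobian_works[symmetric] differentiable_on_def)
  have "(?f has_derivative (\<lambda>h. ?g \<bullet> h)) (at u')"
    unfolding bregman_def
    by (rule derivative_eq_intros lin Phi lipschitz_gradient_derivative[OF K] refl)+
      (simp add: fun_eq_iff inner_add_left inner_add_right inner_diff_left inner_transpose_mult right_diff_distrib del: transpose_matrix_vector)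
  moreover have "U \<noteq> UNIV \<Longrightarrow> lipschitz_around J u'"
    using J(2) u'_in_U finite by (auto simp: edom_def)
  ultimately obtain \<xi> \<zeta> where "\<xi> \<in> limiting_subdiff J u'" "\<zeta> \<in> normal_cone U u'" "?g + \<xi> + \<zeta> = 0"
    using first_order_condition[where U = U and x = u' and J = J and f = ?f and g = ?g, OF U u'_in_U finite _ _ u_min_real]
    by blast
  then show ?thesis using that by blast
qed

lemma subgradient_bound:
  "\<exists>g\<in>subdiff_L (u', v', p'). norm g \<le> residual_bound Q E * d"
proof -
  obtain \<xi> \<zeta> where \<xi>: "\<xi> \<in> limiting_subdiff J u'" and \<zeta>: "\<zeta> \<in> normal_cone U u'"
    and stat: "grad1 G u v + transpose (jacobian \<Omega> (at u)) *v q + transpose (jacobian \<Phi> (at u')) *v q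
       + (1 / e) *\<^sub>R (grad K u' - grad K u) + \<xi> + \<zeta> = 0"
    by (rule u_stationary)
  define g1 where "g1 = grad1 G u' v' + \<xi> + \<zeta> + transpose (jacobian \<Theta> (at u')) *v q'"
  define g2 where "g2 = grad2 G u' v' + grad H v' + transpose B *v q'"
  define g3 where "g3 = \<Theta> u' + B *v v'"
  have "(g1, g2, g3) \<in> subdiff_L (u', v', p')"
    using \<xi> \<zeta> u'_in_U
    unfolding aug_lagrangian_subdiff_def g1_def g2_def g3_def multiplier_estimate_def by auto
  moreover have "norm g1 \<le> (L_G + L\<^sub>\<Theta> * (1 + \<gamma> * \<rho>) + L_\<Omega> * Q + E * L_K) * d"
  proof -
    have dd: "\<Omega> differentiable (at x)" "\<Phi> differentiable (at x)" for x
      using diff by (auto simp: differentiable_on_def)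
    have jac: "transpose (jacobian \<Theta> (at u')) *v q = transpose (jacobian \<Omega> (at u')) *v q + transpose (jacobian \<Phi> (at u')) *v q"
      unfolding jacobian_add[OF dd]
      by (simp add: vec_eq_iff transpose_def matrix_vector_mult_def sum.distrib distrib_right)
    let ?a = "grad1 G u' v' - grad1 G u v"
    let ?b = "transpose (jacobian \<Theta> (at u')) *v (q' - q)"
    let ?c = "transpose (jacobian \<Omega> (at u') - jacobian \<Omega> (at u)) *v q"
    let ?d = "(1 / e) *\<^sub>R (grad K u' - grad K u)"
    \<comment> \<open>Zero is replaced by the optimality condition with the same
      \<open>\<xi>\<close> and \<open>\<zeta>\<close>. These cancel, and only differences of smooth
      terms between the two iterates remain.\<close>
    have "g1 = g1 - 0" by simp
    also have "\<dots> = ?a + ?b + ?c - ?d"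
      unfolding g1_def stat[symmetric] transpose_diff_mult matrix_vector_mult_diff_distrib jac by simp
    finally have eq: "g1 = ?a + ?b + ?c - ?d" .
    have "norm g1 \<le> norm ?a + norm ?b + norm ?c + norm ?d"
      unfolding eq using norm_triangle_ineq4[of "?a + ?b + ?c" ?d] norm_triangle_ineq[of "?a + ?b" ?c] norm_triangle_ineq[of ?a ?b]
      by linarith
    also have "norm ?a \<le> L_G * d"
    proof -
      have "norm ?a \<le> norm (grad G (u', v') - grad G (u, v))"
        using G norm_fst_le[where x = "grad1 G u' v' - grad1 G u v" and y = "grad2 G u' v' - grad2 G u v"]
        by (simp add: grad_partials lipschitz_gradient_def differentiable_on_def)
      also have "\<dots> \<le> L_G * d"
        using norm_step_le nonneg by (intro order.trans[OF lipschitz_gradient_norm_diff[OF G]] mult_left_mono)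
      finally show ?thesis .
    qed
    also have "norm ?b \<le> L\<^sub>\<Theta> * (1 + \<gamma> * \<rho>) * d"
    proof -
      have "norm ?b \<le> L\<^sub>\<Theta> * norm (q' - q)"
        by (intro norm_transpose_mult_le norm_jacobian_mult_le nonneg differentiable_add dd Theta_lipschitz[rule_format])
      also have "\<dots> \<le> L\<^sub>\<Theta> * ((1 + \<gamma> * \<rho>) * d)"
        by (intro mult_left_mono norm_multiplier_diff nonneg)
      finally show ?thesis by (simp add: mult.assoc)
    qed
    also have "norm ?c \<le> L_\<Omega> * Q * d"
    proof -
      have "norm ?c \<le> L_\<Omega> * norm (u' - u) * norm q"
        using nonneg by (intro norm_transpose_mult_le jacobian_Omega_lipschitz) auto
      also have "\<dots> \<le> L_\<Omega> * d * Q"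
        using nonneg norm_step_le Q by (intro mult_mono mult_nonneg_nonneg) auto
      finally show ?thesis by (simp add: mult_ac)
    qed
    also have "norm ?d \<le> E * L_K * d"
    proof -
      have "norm ?d = 1 / e * norm (grad K u' - grad K u)" using e by simp
      also have "\<dots> \<le> E * (L_K * norm (u' - u))"
        using e bounds_nonneg by (intro mult_mono lipschitz_gradient_norm_diff[OF K]) auto
      also have "\<dots> \<le> E * (L_K * d)"
        using bounds_nonneg nonneg norm_step_le by (intro mult_left_mono)
      finally show ?thesis by simp
    qed
    finally show ?thesis by (simp add: distrib_right)
  qed
  moreover have "norm g2 \<le> (L_G + L_H + spectral_norm B * (1 + \<gamma> * \<rho>) + \<gamma> * (spectral_norm B)\<^sup>2) * d"
  proof -
    let ?a = "grad2 G u' v' - grad2 G u v"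
    let ?b = "grad H v' - grad H v"
    let ?c = "transpose B *v (q' - q)"
    let ?d = "\<gamma> *\<^sub>R (transpose B *v (B *v (v' - v)))"
    have tB: "norm (transpose B *v y) \<le> spectral_norm B * norm y" for y
      by (intro norm_transpose_mult_le norm_spectral_norm spectral_norm_nonneg)
    \<comment> \<open>The same subtraction with \<open>v_stationary\<close>; the proximal term
      survives as \<open>?d\<close>.\<close>
    have "g2 = g2 - 0" by simp
    also have "\<dots> = ?a + ?b + ?c - ?d"
      unfolding g2_def v_stationary[symmetric] matrix_vector_mult_diff_distrib by simp
    finally have eq: "g2 = ?a + ?b + ?c - ?d" .
    have "norm g2 \<le> norm ?a + norm ?b + norm ?c + norm ?d"
      unfolding eq using norm_triangle_ineq4[of "?a + ?b + ?c" ?d] norm_triangle_ineq[of "?a + ?b" ?c] norm_triangle_ineq[of ?a ?b]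
      by linarith
    also have "norm ?a \<le> L_G * d"
    proof -
      have "norm ?a \<le> norm (grad G (u', v') - grad G (u, v))"
        using G norm_snd_le[where x = "grad1 G u' v' - grad1 G u v" and y = "grad2 G u' v' - grad2 G u v"]
        by (simp add: grad_partials lipschitz_gradient_def differentiable_on_def)
      also have "\<dots> \<le> L_G * d"
        using norm_step_le nonneg by (intro order.trans[OF lipschitz_gradient_norm_diff[OF G]] mult_left_mono)
      finally show ?thesis .
    qed
    also have "norm ?b \<le> L_H * d"
      using norm_step_le nonneg by (intro order.trans[OF lipschitz_gradient_norm_diff[OF H]] mult_left_mono)
    also have "norm ?c \<le> spectral_norm B * (1 + \<gamma> * \<rho>) * d"
    proof -
      have "norm ?c \<le> spectral_norm B * ((1 + \<gamma> * \<rho>) * d)"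
        by (intro order.trans[OF tB] mult_left_mono norm_multiplier_diff spectral_norm_nonneg)
      then show ?thesis by (simp add: mult.assoc)
    qed
    also have "norm ?d \<le> \<gamma> * (spectral_norm B)\<^sup>2 * d"
    proof -
      have "norm (transpose B *v (B *v (v' - v))) \<le> spectral_norm B * (spectral_norm B * d)"
        using norm_step_le(2) spectral_norm_nonneg[of B]
        by (intro order.trans[OF tB] mult_left_mono order.trans[OF norm_spectral_norm]) auto
      then show ?thesis using gamma by (simp add: power2_eq_square mult.assoc)
    qed
    finally show ?thesis by (simp add: distrib_right)
  qed
  moreover have "norm g3 \<le> 1 / \<gamma> * d"
    unfolding g3_def primal_residual using gamma norm_step_le(3) by (simp add: divide_right_mono)
  moreover have "norm (g1, g2, g3) \<le> norm g1 + (norm g2 + norm g3)"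
    using norm_Pair_le[of g1 "(g2, g3)"] norm_Pair_le[of g2 g3] by linarith
  ultimately show ?thesis
    unfolding residual_bound_def distrib_right by (intro bexI[of _ "(g1, g2, g3)"]) linarith+
qed

end

text \<open>Both values are expanded at a third point \<open>c\<close>. In the application it is the
  old iterate, where the algorithm evaluates its gradients, so the linear parts can cancel.\<close>

lemma lipschitz_gradient_diff_le:
  fixes f :: "'a::euclidean_space \<Rightarrow> real"
  assumes "lipschitz_gradient L f" "norm (a - c) \<le> s" "norm (b - c) \<le> t"
  shows "f a - f b \<le> grad f c \<bullet> (a - b) + L * (s\<^sup>2 + t\<^sup>2)"
proof -
  have "L * (norm (a - c))\<^sup>2 \<le> L * s\<^sup>2" "L * (norm (b - c))\<^sup>2 \<le> L * t\<^sup>2"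
    using assms lipschitz_gradient_nonneg[OF assms(1)] by (auto intro!: mult_left_mono power_mono)
  moreover have "grad f c \<bullet> (a - b) = grad f c \<bullet> (a - c) - grad f c \<bullet> (b - c)"
    by (simp add: inner_diff_right)
  ultimately show ?thesis
    using lipschitz_gradient_taylor[OF assms(1), of a c] lipschitz_gradient_taylor[OF assms(1), of b c]
    unfolding distrib_left by linarith
qed

section \<open>Comparison of Lagrangian values with a feasible competitor\<close>

context napp_step
begin

text \<open>Minimality of \<open>u'\<close> against \<open>x\<close> cancels the
  \<open>u\<close>-linear parts of the expansions of \<open>G\<close> and \<open>\<Omega>\<close>.
  Feasibility of \<open>(x, y)\<close> and stationarity in \<open>v\<close> reduce the rest to
  \<open>- (q \<bullet> r')\<close>, which meets \<open>p' \<bullet> r'\<close> from the Lagrangian.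
  What remains are Taylor remainders and products of two factors of order \<open>d\<close>.\<close>

lemma value_le:
  assumes x: "x \<in> U" and feas: "\<Theta> x + B *v y = 0"
    and M: "0 \<le> M" "norm ((x, y, s) - (u', v', p')) \<le> M * d"
  shows "\<L> (u', v', p') \<le> \<L> (x, y, s) + ereal (value_bound Q E M * d\<^sup>2)"
proof (cases "J x = \<infinity>")
  case True
  then show ?thesis by (simp add: aug_lagrangian_def objective_def)
next
  case False
  then obtain jx where jx: "J x = ereal jx"
    using J(1) by (cases "J x") (auto simp: proper_def)
  obtain j' where j': "J u' = ereal j'" using finite by auto
  let ?A = "jacobian \<Omega> (at u)"
  define r where "r = \<Theta> u + B *v v"
  define r' where "r' = \<Theta> u' + B *v v'"
  \<comment> \<open>Distance from the competitor to the old iterate: at most \<open>M * d\<close> to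
    the new iterate, plus one step.\<close>
  define t where "t = (1 + M) * d"
  define T where "T = d\<^sup>2 + t\<^sup>2"
  have T: "T = (1 + (1 + M)\<^sup>2) * d\<^sup>2" unfolding T_def t_def by (simp add: algebra_simps power2_eq_square)
  have close: "norm (x - u) \<le> t" "norm ((x, y) - (u, v)) \<le> t" "norm (y - v) \<le> t" "norm (v' - y) \<le> M * d"
  proof -
    have eq: "(x, y, s) - (u, v, p) = ((x, y, s) - (u', v', p')) - ((u, v, p) - (u', v', p'))" by simp
    have *: "norm ((x, y, s) - (u, v, p)) \<le> t"
      unfolding eq t_def distrib_right using norm_triangle_ineq4[of "(x, y, s) - (u', v', p')" "(u, v, p) - (u', v', p')"] M(2)
      by linarith
    show "norm (x - u) \<le> t"
      using * norm_fst_le[where x = "x - u" and y = "(y - v, s - p)"] by simp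
    show xy: "norm ((x, y) - (u, v)) \<le> t"
      using * by (intro order.trans[OF _ *]) (simp add: norm_Pair)
    show "norm (y - v) \<le> t"
      using xy norm_snd_le[where x = "x - u" and y = "y - v"] by simp
    have "norm (y - v') \<le> norm ((x, y, s) - (u', v', p'))"
      using norm_snd_le[where x = "x - u'" and y = "(y - v', s - p')"] norm_fst_le[where x = "y - v'" and y = "s - p'"] by simp
    then show "norm (v' - y) \<le> M * d" using M(2) by (simp add: norm_minus_commute)
  qed
  have G_le: "G (u', v') - G (x, y) \<le> grad1 G u v \<bullet> (u' - x) + grad2 G u v \<bullet> (v' - y) + L_G * T"
    using lipschitz_gradient_diff_le[OF G norm_step_le(4) close(2)] G
    by (simp add: grad_partials lipschitz_gradient_def differentiable_on_def T_def)
  have H_le: "H v' - H y \<le> grad H v \<bullet> (v' - y) + L_H * T"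
    using lipschitz_gradient_diff_le[OF H norm_step_le(2) close(3)] by (simp add: T_def)
  have O_le: "q \<bullet> (\<Omega> u' - \<Omega> x) \<le> q \<bullet> (?A *v (u' - x)) + Q * L_\<Omega> * T"
  proof -
    have *: "norm q * (L_\<Omega> * (norm (z - u))\<^sup>2) \<le> Q * (L_\<Omega> * c\<^sup>2)" if "norm (z - u) \<le> c" for z c
      using that Q nonneg bounds_nonneg by (intro mult_mono mult_left_mono power_mono mult_nonneg_nonneg) auto
    have "q \<bullet> (\<Omega> u' - \<Omega> x) - q \<bullet> (?A *v (u' - x))
        = q \<bullet> (\<Omega> u' - \<Omega> u - ?A *v (u' - u)) - q \<bullet> (\<Omega> x - \<Omega> u - ?A *v (x - u))"
      by (simp add: inner_diff_right matrix_vector_mult_diff_distrib)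
    also have "\<dots> \<le> Q * (L_\<Omega> * d\<^sup>2) + Q * (L_\<Omega> * t\<^sup>2)"
      using Omega_taylor[of q u' u] Omega_taylor[of q x u] *[OF norm_step_le(1)] *[OF close(1)] by linarith
    finally show ?thesis unfolding T_def by (simp add: algebra_simps)
  qed
  have K_le: "1 / e * bregman K x u - 1 / e * bregman K u' u \<le> E * L_K * T"
  proof -
    have "bregman K x u - bregman K u' u \<le> L_K * T"
      using lipschitz_gradient_diff_le[OF K close(1) norm_step_le(1)]
      by (simp add: bregman_def T_def inner_diff_right add.commute)
    then have "1 / e * (bregman K x u - bregman K u' u) \<le> 1 / e * (L_K * T)"
      using e by (intro mult_left_mono) auto
    also have "\<dots> \<le> E * (L_K * T)"
      using e nonneg by (intro mult_right_mono) (auto simp: T_def)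
    finally show ?thesis by (simp add: right_diff_distrib)
  qed
  have J_le: "j' - jx \<le> grad1 G u v \<bullet> (x - u') + q \<bullet> (?A *v (x - u') + \<Phi> x - \<Phi> u')
      + (1 / e * bregman K x u - 1 / e * bregman K u' u)"
    using u_min_real[OF x] unfolding jx j'
    by (simp add: inner_diff_right inner_add_right matrix_vector_mult_diff_distrib)
  have v_eq: "(grad2 G u v + grad H v) \<bullet> (v' - y) + q \<bullet> (B *v (v' - y)) = - \<gamma> * ((B *v (v' - v)) \<bullet> (B *v (v' - y)))"
  proof -
    have "(grad2 G u v + grad H v + transpose B *v q + \<gamma> *\<^sub>R (transpose B *v (B *v (v' - v)))) \<bullet> (v' - y) = 0"
      by (simp only: v_stationary inner_zero_left)
    then show ?thesis
      by (simp only: inner_add_left inner_scaleR_left inner_transpose_mult)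
  qed
  have v_le: "- \<gamma> * ((B *v (v' - v)) \<bullet> (B *v (v' - y))) \<le> \<gamma> * (spectral_norm B)\<^sup>2 * M * d\<^sup>2"
  proof -
    have "\<bar>(B *v (v' - v)) \<bullet> (B *v (v' - y))\<bar> \<le> (spectral_norm B * d) * (spectral_norm B * (M * d))"
      using norm_step_le(2) close(4) spectral_norm_nonneg[of B]
      by (intro order.trans[OF Cauchy_Schwarz_ineq2] mult_mono mult_left_mono order.trans[OF norm_spectral_norm] mult_nonneg_nonneg)
        auto
    then have "\<gamma> * - ((B *v (v' - v)) \<bullet> (B *v (v' - y))) \<le> \<gamma> * ((spectral_norm B * d) * (spectral_norm B * (M * d)))"
      using gamma by (intro mult_left_mono) auto
    then show ?thesis by (simp add: power2_eq_square mult_ac)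
  qed
  have nr': "norm r' \<le> d / \<gamma>"
    unfolding r'_def primal_residual using gamma norm_step_le(3) by (simp add: divide_right_mono)
  \<comment> \<open>\<open>p'\<close> and \<open>q\<close> add to \<open>p\<close> the new and the
    old residual respectively, scaled by \<open>\<gamma>\<close>. So
    \<open>p' - q = \<gamma> *\<^sub>R (r' - r)\<close>, and both \<open>r' - r\<close> and
    \<open>r'\<close> are of order \<open>d\<close>.\<close>
  have p_le: "(p' - q) \<bullet> r' \<le> \<rho> * d\<^sup>2"
  proof -
    have "norm (r' - r) \<le> \<rho> * d"
      unfolding r_def r'_def using nonneg norm_step_le(4)
      by (intro order.trans[OF residual_lipschitz] mult_left_mono)
    then have "norm (r' - r) * norm r' \<le> (\<rho> * d) * (d / \<gamma>)"
      using nr' nonneg by (intro mult_mono) auto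
    then have "(r' - r) \<bullet> r' \<le> (\<rho> * d) * (d / \<gamma>)"
      by (rule order.trans[OF norm_cauchy_schwarz])
    then have "\<gamma> * ((r' - r) \<bullet> r') \<le> \<gamma> * ((\<rho> * d) * (d / \<gamma>))"
      using gamma by (intro mult_left_mono) auto
    moreover have "p' - q = \<gamma> *\<^sub>R (r' - r)"
      unfolding p' q multiplier_estimate_def r_def r'_def by (simp add: scaleR_diff_right)
    ultimately show ?thesis using gamma by (simp add: power2_eq_square)
  qed
  have r_le: "\<gamma> / 2 * (norm r')\<^sup>2 \<le> 1 / (2 * \<gamma>) * d\<^sup>2"
  proof -
    have "\<gamma> / 2 * (norm r')\<^sup>2 \<le> \<gamma> / 2 * (d / \<gamma>)\<^sup>2"
      using nr' gamma by (intro mult_left_mono power_mono) auto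
    then show ?thesis using gamma by (simp add: power2_eq_square)
  qed
  \<comment> \<open>Feasibility enters here: the left side equals
    \<open>q \<bullet> (\<Theta> x - \<Theta> u')\<close>, and
    \<open>\<Theta> x = - (B *v y)\<close>.\<close>
  have split: "q \<bullet> (?A *v (x - u') + \<Phi> x - \<Phi> u') - q \<bullet> (\<Omega> u' - \<Omega> x) + q \<bullet> (?A *v (u' - x))
      = q \<bullet> (B *v (v' - y)) - q \<bullet> r'"
  proof -
    have "- \<Omega> x - \<Phi> x = B *v y" 
      using feas[unfolded add_eq_0_iff] by simp
    then have "q \<bullet> (B *v y) = q \<bullet> (- \<Omega> x - \<Phi> x)" by simp
    then show ?thesis unfolding r'_def
      by (simp add: inner_diff_right inner_add_right matrix_vector_mult_diff_distrib)
  qed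
  have "G (u', v') + j' + H v' + (p' \<bullet> r' + \<gamma> / 2 * (norm r')\<^sup>2)
      \<le> G (x, y) + jx + H y + value_bound Q E M * d\<^sup>2"
  proof -
    have vb: "value_bound Q E M * d\<^sup>2 = L_G * T + L_H * T + Q * L_\<Omega> * T + E * L_K * T
        + \<gamma> * (spectral_norm B)\<^sup>2 * M * d\<^sup>2 + \<rho> * d\<^sup>2 + 1 / (2 * \<gamma>) * d\<^sup>2"
      unfolding value_bound_def T by (simp only: distrib_right mult.assoc)
    have sg: "grad1 G u v \<bullet> (x - u') = - (grad1 G u v \<bullet> (u' - x))"
      by (simp add: inner_diff_right)
    have "(p' - q) \<bullet> r' = p' \<bullet> r' - q \<bullet> r'" by (simp add: inner_diff_left)
    then show ?thesis unfolding vb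
      using G_le H_le O_le K_le J_le v_eq[unfolded inner_add_left] v_le p_le r_le split sg by linarith
  qed
  then show ?thesis
    unfolding aug_lagrangian_def objective_def by (simp add: jx j' feas r'_def)
qed

end

section \<open>The value proximity error bound\<close>

lemma (in napp_problem) residual_bound_pos:
  assumes "0 \<le> Q" "0 \<le> E"
  shows "0 < residual_bound Q E"
  unfolding residual_bound_def
  using assms nonneg spectral_norm_nonneg[of B] gamma
  by (intro add_nonneg_pos add_nonneg_nonneg mult_nonneg_nonneg) auto

lemma edist_set_less:
  assumes "edist_set x C < ereal r"
  obtains z where "z \<in> C" "dist x z < r"
  using assms unfolding edist_set_def by (auto simp: INF_less_iff)

lemma edist_set_le: "z \<in> C \<Longrightarrow> edist_set x C \<le> ereal (dist x z)"
  unfolding edist_set_def by (rule INF_lower)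

text \<open>The infimum defining the distance need not be attained, so the factor 2 buys a strict
  inequality when \<open>0 < c\<close>. If \<open>g = 0\<close>, the point \<open>w\<close> itself
  serves as \<open>z\<close>.\<close>

lemma metrically_subregular_near:
  fixes F :: "'a::metric_space \<Rightarrow> 'b::real_normed_vector set"
  assumes "metrically_subregular F wbar \<kappa> \<eta>" "w \<in> ball wbar \<eta>" "0 < \<kappa>"
    and "g \<in> F w" "norm g \<le> c" "0 < c \<or> g = 0"
  obtains z where "0 \<in> F z" "dist w z \<le> 2 * \<kappa> * c"
proof (cases "g = 0")
  case True
  have "0 \<le> c" using assms(5) order.trans[OF norm_ge_zero] by blast
  then show ?thesis using that[of w] True assms by simp
next
  case False
  then have "0 < c" using assms by blast
  have "edist_set w {x. 0 \<in> F x} \<le> ereal \<kappa> * edist_set 0 (F w)"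
    using assms unfolding metrically_subregular_def by blast
  also have "\<dots> \<le> ereal \<kappa> * ereal c"
    using assms edist_set_le[OF assms(4), of 0]
    by (intro ereal_mult_left_mono) (auto intro: order.trans)
  also have "\<dots> < ereal (2 * \<kappa> * c)" using \<open>0 < c\<close> assms by simp
  finally obtain z where "z \<in> {x. 0 \<in> F x}" "dist w z < 2 * \<kappa> * c"
    by (rule edist_set_less)
  then show ?thesis using that by auto
qed

theorem proposition6p2:
  fixes U :: "(real^'n) set"
    and G :: "(real^'n) \<times> (real^'d) \<Rightarrow> real"
    and J :: "real^'n \<Rightarrow> ereal"
    and H :: "real^'d \<Rightarrow> real"
    and \<Omega> \<Phi> \<Theta> :: "real^'n \<Rightarrow> real^'m"
    and B :: "real^'d^'m"
    and K :: "real^'n \<Rightarrow> real"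
    and L_G L_H L\<^sub>\<Theta> L_\<Omega> L_K \<beta> \<gamma> \<sigma> :: real
    and L_\<Omega>j :: "'m \<Rightarrow> real"
    and \<delta>k \<epsilon> :: "nat \<Rightarrow> real"
    and u :: "nat \<Rightarrow> real^'n" and v :: "nat \<Rightarrow> real^'d" and p q :: "nat \<Rightarrow> real^'m"
    and w :: "nat \<Rightarrow> (real^'n) \<times> (real^'d) \<times> (real^'m)"
    and wbar :: "(real^'n) \<times> (real^'d) \<times> (real^'m)"
    and \<delta> \<kappa>\<^sub>3 \<eta> :: real
  assumes U: "U \<noteq> {}" "closed U" "convex U"
    and Theta: "\<Theta> = (\<lambda>x. \<Omega> x + \<Phi> x)"
    and diff: "\<Omega> differentiable_on UNIV" "\<Phi> differentiable_on UNIV"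
    and H1: "lipschitz_gradient L_G G"
    and H2: "lipschitz_gradient L_H H"
    and H3: "proper J" "lsc J"
            "U = UNIV \<Longrightarrow> convex (edom J)"
            "U \<noteq> UNIV \<Longrightarrow> \<forall>x \<in> edom J \<inter> U. lipschitz_around J x"
    and H4: "\<forall>x x'. norm (\<Theta> x - \<Theta> x') \<le> L\<^sub>\<Theta> * norm (x - x')"
    and H5: "\<forall>j. lipschitz_gradient (L_\<Omega>j j) (\<lambda>x. \<Omega> x $ j)"
            "L_\<Omega> = (\<Sum>j\<in>UNIV. L_\<Omega>j j)"
    and H6: "CARD('d) \<le> CARD('m)" "rank B = CARD('d)" "range \<Theta> \<subseteq> range (\<lambda>y. B *v y)"
    and H7: "\<exists>c::real. \<forall>z \<in> feasible \<Theta> B. ereal c \<le> objective G J H z"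
            "(objective G J H \<longlongrightarrow> \<infinity>) (inf at_infinity (principal (feasible \<Theta> B)))"
    and A2i: "\<beta> > 0" "strongly_convex \<beta> K" "lipschitz_gradient L_K K"
    and A2ii: "\<gamma> > 0" "\<gamma> > (sqrt 57 + 1) / (2 * lambda_min (transpose B ** B)) * (L_G + L_H)"
    and sigma: "0 < \<sigma>" "\<sigma> < 1"
    and alg: "napp_al U G J H \<Omega> \<Phi> B K \<gamma> \<sigma> \<delta>k \<epsilon> u v p"
    and w: "\<forall>k. w k = (u k, v k, p k)"
    and q: "\<forall>k. q k = multiplier_estimate \<Theta> B \<gamma> (u k) (v k) (p k)"
    and delta_k: "\<forall>k. \<delta>k k = \<beta> * inverse
           (L_G + norm (q k) * L_\<Omega> + \<gamma> * L\<^sub>\<Theta>\<^sup>2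
            + 14 * \<gamma> * (spectral_norm B)\<^sup>2 * L\<^sub>\<Theta>\<^sup>2 / lambda_min (transpose B ** B)
            + 14 * (L_G + \<gamma> * spectral_norm B * L\<^sub>\<Theta>)\<^sup>2 / (\<gamma> * lambda_min (transpose B ** B))
            + 1)"
    and cluster: "cluster_point w wbar"
    and delta: "\<delta> > 0"
    and stat_le: "\<forall>z \<in> stationary_points U G J H \<Theta> B \<gamma>. norm (z - wbar) \<le> \<delta> \<longrightarrow>
                    aug_lagrangian G J H \<Theta> B \<gamma> z \<le> aug_lagrangian G J H \<Theta> B \<gamma> wbar"
    and subreg: "\<kappa>\<^sub>3 > 0" "\<eta> > 0" "\<eta> < \<delta>"
                "metrically_subregular (aug_lagrangian_subdiff U G J H \<Theta> B \<gamma>) wbar \<kappa>\<^sub>3 \<eta>"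
  shows "vp_eb (aug_lagrangian G J H \<Theta> B \<gamma>) w wbar"
proof (cases "aug_lagrangian G J H \<Theta> B \<gamma> wbar = \<infinity>")
  case True
  show ?thesis
    unfolding vp_eb_def
  proof (intro exI[of _ "1::real"] conjI allI impI)
    fix k
    assume "w (Suc k) \<in> ball wbar 1 \<and>
      aug_lagrangian G J H \<Theta> B \<gamma> (w (Suc k)) < aug_lagrangian G J H \<Theta> B \<gamma> wbar + ereal 1"
    \<comment> \<open>The strict inequality excludes the value \<open>\<infinity>\<close> at
      \<open>w (Suc k)\<close>; any other value minus \<open>\<infinity>\<close> is
      \<open>-\<infinity>\<close>.\<close>
    then show "aug_lagrangian G J H \<Theta> B \<gamma> (w (Suc k)) - aug_lagrangian G J H \<Theta> B \<gamma> wbar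
        \<le> ereal (1 * (norm (w k - w (Suc k)))\<^sup>2)"
      unfolding True by (cases "aug_lagrangian G J H \<Theta> B \<gamma> (w (Suc k))") auto
  qed auto
next
  case False
  interpret P: napp_problem U G J H \<Omega> \<Phi> B K L_G L_H L\<^sub>\<Theta> L_K \<gamma> L_\<Omega>j
    using U diff H1 H2 H3 H4 H5 A2i A2ii unfolding Theta by unfold_locales auto
  obtain ub vb pb where wbar: "wbar = (ub, vb, pb)" by (cases wbar)
  have Jinf: "J x \<noteq> -\<infinity>" for x using H3(1) by (simp add: proper_def)
  have "P.\<L> wbar \<noteq> -\<infinity>"
    using Jinf[of ub] unfolding wbar aug_lagrangian_def objective_def by simp
  with False obtain l where l: "P.\<L> wbar = ereal l"
    unfolding Theta by (cases "P.\<L> wbar") auto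
  define \<mu> where "\<mu> = lambda_min (transpose B ** B)"
  define c0 where "c0 = \<gamma> * L\<^sub>\<Theta>\<^sup>2 + 14 * \<gamma> * (spectral_norm B)\<^sup>2 * L\<^sub>\<Theta>\<^sup>2 / \<mu>
            + 14 * (L_G + \<gamma> * spectral_norm B * L\<^sub>\<Theta>)\<^sup>2 / (\<gamma> * \<mu>) + 1"
  \<comment> \<open>The radius \<open>\<eta> + 1\<close> accommodates \<open>w k\<close>: the new
    iterate is within \<open>\<eta>\<close> of \<open>wbar\<close> and a short step has length below
    1.\<close>
  define Q where "Q = norm (multiplier_estimate P.\<Theta> B \<gamma> ub vb pb) + (1 + \<gamma> * P.\<rho>) * (\<eta> + 1)"
  \<comment> \<open>From \<open>\<sigma> * \<delta>k k \<le> \<epsilon> k\<close> and the formula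
    for \<open>\<delta>k\<close>, with \<open>norm (q k)\<close> replaced by \<open>Q\<close>. The
    \<open>max 0\<close> yields nonnegativity without inspecting the sign of
    \<open>\<mu>\<close>.\<close>
  define E where "E = max 0 ((L_G + Q * L_\<Omega> + c0) / (\<sigma> * \<beta>))"
  define C where "C = P.residual_bound Q E"
  define M where "M = 2 * \<kappa>\<^sub>3 * C"
  \<comment> \<open>Threshold between long and short steps.
    \<open>M * c \<le> \<delta> - \<eta>\<close> places the stationary point within
    \<open>\<delta>\<close> of \<open>wbar\<close>, where \<open>stat_le\<close> applies.\<close>
  define c where "c = min 1 ((\<delta> - \<eta>) / M)"
  have lip0: "0 \<le> 1 + \<gamma> * P.\<rho>" using P.nonneg A2ii by simp
  then have Q0: "0 \<le> Q" unfolding Q_def using subreg(2)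
    by (intro add_nonneg_nonneg norm_ge_zero mult_nonneg_nonneg[OF lip0]) simp_all
  have C: "0 < C" unfolding C_def by (rule P.residual_bound_pos[OF Q0]) (simp add: E_def)
  then have M: "0 < M" unfolding M_def using subreg by simp
  have c: "0 < c" "c \<le> 1" "M * c \<le> \<delta> - \<eta>"
    unfolding c_def using M subreg by (auto simp: min_def field_simps)
  have main: "P.\<L> (w (Suc k)) - ereal l
      \<le> ereal (max (1 / c\<^sup>2) (P.value_bound Q E M) * (norm (w k - w (Suc k)))\<^sup>2)"
    if near: "w (Suc k) \<in> ball wbar \<eta>" and below: "P.\<L> (w (Suc k)) < ereal l + ereal 1" for k
  proof -
    let ?d = "norm (w k - w (Suc k))"
    have shift: "P.\<L> (w (Suc k)) - ereal l \<le> ereal b" if "P.\<L> (w (Suc k)) \<le> ereal (l + b)" for b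
      using that by (cases "P.\<L> (w (Suc k))") auto
    \<comment> \<open>A real bound \<open>b\<close> keeps the case analysis free of
      \<open>ereal\<close> subtraction; \<open>shift\<close> restores it afterwards.\<close>
    have "\<exists>b. P.\<L> (w (Suc k)) \<le> ereal (l + b) \<and> b \<le> max (1 / c\<^sup>2) (P.value_bound Q E M) * ?d\<^sup>2"
    proof (cases "c \<le> ?d")
      case True
      have "1 \<le> 1 / c\<^sup>2 * ?d\<^sup>2" using power_mono[OF True, of 2] c by simp
      also have "\<dots> \<le> max (1 / c\<^sup>2) (P.value_bound Q E M) * ?d\<^sup>2" by (intro mult_right_mono) auto
      finally show ?thesis using less_imp_le[OF below] by (intro exI[of _ 1]) simp
    next
      case False
      have J': "\<bar>J (u (Suc k))\<bar> \<noteq> \<infinity>"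
        using below Jinf[of "u (Suc k)"] w by (auto simp: aug_lagrangian_def objective_def)
      have dist': "norm (w (Suc k) - wbar) < \<eta>"
        using near by (simp add: dist_norm norm_minus_commute)
      have "norm (w k - wbar) \<le> \<eta> + 1"
        using norm_triangle_ineq[of "w k - w (Suc k)" "w (Suc k) - wbar"] dist' False c by simp
      then have "norm (q k - multiplier_estimate P.\<Theta> B \<gamma> ub vb pb) \<le> (1 + \<gamma> * P.\<rho>) * (\<eta> + 1)"
        using order.trans[OF P.multiplier_lipschitz mult_left_mono[OF _ lip0]] w q
        unfolding wbar Theta by simp
      then have qQ: "norm (q k) \<le> Q"
        unfolding Q_def using norm_triangle_sub[of "q k" "multiplier_estimate P.\<Theta> B \<gamma> ub vb pb"] by linarith
      define X where "X = L_G + norm (q k) * L_\<Omega> + c0"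
      note step = alg[unfolded napp_al_def Let_def, rule_format, of k]
      have dk: "\<delta>k k = \<beta> * inverse X"
        using delta_k unfolding X_def c0_def \<mu>_def by (simp add: add.assoc)
      have pos: "\<delta>k k > 0" "\<sigma> * \<delta>k k \<le> \<epsilon> k" "\<epsilon> k > 0"
        using step sigma by (auto intro: less_le_trans[OF mult_pos_pos])
      \<comment> \<open>The sign of the bracket is read off from \<open>\<delta>k k > 0\<close>,
        which the algorithm demands.\<close>
      have X: "X > 0" using pos(1) A2i unfolding dk by (simp add: zero_less_mult_iff)
      have "1 / \<epsilon> k \<le> 1 / (\<sigma> * \<delta>k k)"
        using pos sigma by (intro divide_left_mono) auto
      also have "\<dots> = X / (\<sigma> * \<beta>)" unfolding dk using X by (simp add: field_simps)
      also have "\<dots> \<le> E"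
        unfolding E_def X_def using qQ P.nonneg H5(2) sigma A2i
        by (intro max.coboundedI2 divide_right_mono add_mono mult_right_mono) auto
      finally have E: "1 / \<epsilon> k \<le> E" .
      interpret S: napp_step U G J H \<Omega> \<Phi> B K L_G L_H L\<^sub>\<Theta> L_K \<gamma> L_\<Omega>j
        "u k" "u (Suc k)" "v k" "v (Suc k)" "p k" "p (Suc k)" "q k" "\<epsilon> k" Q E
        using step q J' qQ E pos unfolding Theta by unfold_locales auto
      have d: "S.d = ?d" using w by simp
      obtain g where g: "g \<in> P.subdiff_L (w (Suc k))" "norm g \<le> C * ?d"
        using S.subgradient_bound w unfolding C_def by auto
      \<comment> \<open>A step of length 0 forces \<open>g = 0\<close>, so the degenerate case of
        subregularity is covered.\<close>
      have "0 < C * ?d \<or> g = 0"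
        using g(2) C by (cases "?d = 0") auto
      with metrically_subregular_near[OF subreg(4)[unfolded Theta] near subreg(1) g]
      obtain z where z: "0 \<in> P.subdiff_L z" "dist (w (Suc k)) z \<le> 2 * \<kappa>\<^sub>3 * (C * ?d)"
        by blast
      obtain x y s where zxy: "z = (x, y, s)" by (cases z)
      have feas: "x \<in> U" "P.\<Theta> x + B *v y = 0"
        using z(1) unfolding zxy aug_lagrangian_subdiff_def by (auto split: if_splits simp: zero_prod_def)
      have zd: "norm (z - w (Suc k)) \<le> M * ?d"
        using z(2) by (simp add: M_def dist_norm norm_minus_commute mult.assoc)
      also have "\<dots> \<le> M * c" using False M by (intro mult_left_mono) auto
      finally have "norm (z - wbar) \<le> \<delta>"
        using norm_triangle_ineq[of "z - w (Suc k)" "w (Suc k) - wbar"] dist' c(3) by simp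
      then have "P.\<L> z \<le> ereal l"
        using stat_le[unfolded stationary_points_def Theta l, rule_format, of z] z(1) by blast
      moreover have "P.\<L> (w (Suc k)) \<le> P.\<L> z + ereal (P.value_bound Q E M * ?d\<^sup>2)"
        using S.value_le[OF feas, of M s] M zd w unfolding zxy by simp
      ultimately have "P.\<L> (w (Suc k)) \<le> ereal (l + P.value_bound Q E M * ?d\<^sup>2)"
        using add_right_mono order.trans unfolding plus_ereal.simps(1)[symmetric] by fast
      moreover have "P.value_bound Q E M * ?d\<^sup>2 \<le> max (1 / c\<^sup>2) (P.value_bound Q E M) * ?d\<^sup>2"
        by (intro mult_right_mono) auto
      ultimately show ?thesis by blast
    qed
    then obtain b where "P.\<L> (w (Suc k)) - ereal l \<le> ereal b" "b \<le> max (1 / c\<^sup>2) (P.value_bound Q E M) * ?d\<^sup>2"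
      using shift by blast
    then show ?thesis by (auto elim: order.trans)
  qed
  show ?thesis
    unfolding vp_eb_def Theta l
  proof (rule exI, intro conjI)
    \<comment> \<open>The entry \<open>1 / c\<^sup>2\<close> handles long steps and secures
      positivity; \<open>value_bound\<close> handles short ones.\<close>
    show "0 < max (1 / c\<^sup>2) (P.value_bound Q E M)" using c by (simp add: less_max_iff_disj)
    show "\<exists>\<eta>>0. \<exists>\<nu>>0. \<forall>k. w (Suc k) \<in> ball wbar \<eta> \<and> P.\<L> (w (Suc k)) < ereal l + ereal \<nu> \<longrightarrow>
        P.\<L> (w (Suc k)) - ereal l
          \<le> ereal (max (1 / c\<^sup>2) (P.value_bound Q E M) * (norm (w k - w (Suc k)))\<^sup>2)"
      using subreg(2) by (intro exI[of _ \<eta>] exI[of _ "1::real"] conjI allI impI main) auto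
  qed
qed

end
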